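(* Let $d\ge2$, let $\Gamma$ be a torsion-free uniform lattice in $\mathrm{SO}^+(d,1)$ and $\tau:\Gamma\to\mathbb R^{d+1}$ a cocycle. For every $\tau$-support function $\bar h$ on $\mathbb H^d$ and every $\delta>0$, there is a $C^2_+$ $\tau$-support function $\bar h_\delta$ on $\mathbb H^d$ such that $\|\bar h-\bar h_\delta\|_{L^\infty(\mathbb H^d)}\le\delta$.
   Context: Minkowski space $\mathbb R^{d,1}$ is $\mathbb R^{d+1}$ with $\langle X,Y\rangle_-=\sum_{i=1}^dX_iY_i-X_{d+1}Y_{d+1}$; $I^+(0)=\{X:\langle X,X\rangle_-<0,\ X_{d+1}>0\}$; $\mathbb H^d=\{X:\langle X,X\rangle_-=-1,\ X_{d+1}>0\}$ with the hyperbolic metric $g_{\mathbb H}$. $\mathrm{SO}^+(d,1)$ is the group of orientation preserving linear isometries preserving $I^+(0)$. A uniform lattice is a discrete subgroup $\Gamma$ with $\mathbb H^d/\Gamma$ compact. A cocycle is a map $\tau:\Gamma\to\mathbb R^{d+1}$ with $\tau_{\alpha\beta}=\tau_\alpha+\alpha\tau_\beta$, and $\Gamma_\tau=\{X\mapsto\gamma X+\tau_\gamma\mid\gamma\in\Gamma\}$. A $\tau$-convex set is a non-empty closed convex $K\subsetneq\mathbb R^{d+1}$, invariant under $\Gamma_\tau$, with $K+I^+(0)\subset K$. Its hyperbolic support function is $\bar h(\eta)=\sup_{p\in K}\langle p,\eta\rangle_-$, $\eta\in\mathbb H^d$ (finite). A $\tau$-support function is the hyperbolic support function of a $\tau$-convex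 set; equivalently, a function $\bar h:\mathbb H^d\to\mathbb R$ whose $1$-homogeneous extension to $I^+(0)$ is convex and which satisfies $\bar h(\gamma\eta)=\bar h(\eta)-\langle\tau_{\gamma^{-1}},\eta\rangle_-$ for all $\gamma\in\Gamma$, $\eta\in\mathbb H^d$. It is $C^2_+$ if it is of class $C^2$ and $\nabla^2\bar h-\bar h\,g_{\mathbb H}$ is positive definite at every point ($\nabla^2$ the hyperbolic Hessian); equivalently, the corresponding convex set has $C^2$ boundary and its Gauss map is a $C^1$ diffeomorphism. *)

theory Defs
  imports "HOL-Analysis.Analysis" "HOL-Algebra.Group_Action"
begin

section \<open>Minkowski space and the hyperboloid\<close>

text \<open>
  Vectors of dimension \<open>d + 1\<close> are indexed by \<open>'d option\<close>, where \<open>d = CARD('d)\<close>: the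
  indices \<open>Some i\<close> are the \<open>d\<close> spatial coordinates and \<open>None\<close> is the last, timelike one.
\<close>

type_synonym 'd mvec = "real ^ 'd option"
type_synonym 'd mmat = "real ^ 'd option ^ 'd option"

definition mink :: "'d::finite mvec \<Rightarrow> 'd mvec \<Rightarrow> real" where
  "mink X Y = (\<Sum>i\<in>UNIV. X $ Some i * Y $ Some i) - X $ None * Y $ None"

definition future_cone :: "'d::finite mvec set" where
  "future_cone = {X. mink X X < 0 \<and> X $ None > 0}"

definition hyp :: "'d::finite mvec set" where
  "hyp = {X. mink X X = -1 \<and> X $ None > 0}"


section \<open>Lattices and cocycles\<close>

definition SO_plus :: "'d::finite mmat monoid" where
  "SO_plus = \<lparr>carrier = {A. (\<forall>X Y. mink (A *v X) (A *v Y) = mink X Y) \<and> det A > 0 \<and>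
                            ((*v) A) ` future_cone = future_cone},
              mult = (**), one = mat 1\<rparr>"

definition hyp_orbits :: "'d::finite mmat set \<Rightarrow> 'd mvec set set" where
  "hyp_orbits \<Gamma> = orbits (SO_plus\<lparr>carrier := \<Gamma>\<rparr>) hyp (*v)"

definition hyp_quotient :: "'d::finite mmat set \<Rightarrow> 'd mvec set topology" where
  "hyp_quotient \<Gamma> = topology (\<lambda>U. U \<subseteq> hyp_orbits \<Gamma> \<and>
     openin (top_of_set hyp) {x \<in> hyp. orbit (SO_plus\<lparr>carrier := \<Gamma>\<rparr>) (*v) x \<in> U})"

definition uniform_lattice :: "'d::finite mmat set \<Rightarrow> bool" where
  "uniform_lattice \<Gamma> \<longleftrightarrow>
     subgroup \<Gamma> SO_plus \<and> discrete \<Gamma> \<and> compact_space (hyp_quotient \<Gamma>)"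

definition torsion_free :: "'d::finite mmat set \<Rightarrow> bool" where
  "torsion_free \<Gamma> \<longleftrightarrow>
     (\<forall>\<gamma>\<in>\<Gamma>. \<forall>n::nat. n > 0 \<longrightarrow> \<gamma> [^]\<^bsub>SO_plus\<^esub> n = \<one>\<^bsub>SO_plus\<^esub> \<longrightarrow> \<gamma> = \<one>\<^bsub>SO_plus\<^esub>)"

definition cocycle :: "'d::finite mmat set \<Rightarrow> ('d mmat \<Rightarrow> 'd mvec) \<Rightarrow> bool" where
  "cocycle \<Gamma> \<tau> \<longleftrightarrow> (\<forall>\<alpha>\<in>\<Gamma>. \<forall>\<beta>\<in>\<Gamma>. \<tau> (\<alpha> ** \<beta>) = \<tau> \<alpha> + \<alpha> *v \<tau> \<beta>)"

definition affine_maps ::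
    "'d::finite mmat set \<Rightarrow> ('d mmat \<Rightarrow> 'd mvec) \<Rightarrow> ('d mvec \<Rightarrow> 'd mvec) set" where
  "affine_maps \<Gamma> \<tau> = {\<lambda>X. \<gamma> *v X + \<tau> \<gamma> | \<gamma>. \<gamma> \<in> \<Gamma>}"


section \<open>Support functions\<close>

definition tau_convex ::
    "'d::finite mmat set \<Rightarrow> ('d mmat \<Rightarrow> 'd mvec) \<Rightarrow> 'd mvec set \<Rightarrow> bool" where
  "tau_convex \<Gamma> \<tau> K \<longleftrightarrow>
     K \<noteq> {} \<and> closed K \<and> convex K \<and> K \<noteq> UNIV \<and>
     (\<forall>f\<in>affine_maps \<Gamma> \<tau>. f ` K = K) \<and>
     (\<forall>X\<in>K. \<forall>Y\<in>future_cone. X + Y \<in> K)"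

text \<open>
  The supremum is taken in the extended reals, so the equation also says that it is finite.
  Functions on the hyperboloid are total functions whose values off \<open>hyp\<close> are irrelevant.
\<close>

definition hyp_support_function :: "'d::finite mvec set \<Rightarrow> ('d mvec \<Rightarrow> real) \<Rightarrow> bool" where
  "hyp_support_function K h \<longleftrightarrow>
     (\<forall>\<eta>\<in>hyp. ereal (h \<eta>) = (SUP p\<in>K. ereal (mink p \<eta>)))"

definition tau_support_function ::
    "'d::finite mmat set \<Rightarrow> ('d mmat \<Rightarrow> 'd mvec) \<Rightarrow> ('d mvec \<Rightarrow> real) \<Rightarrow> bool" where
  "tau_support_function \<Gamma> \<tau> h \<longleftrightarrow>
     (\<exists>K. tau_convex \<Gamma> \<tau> K \<and> hyp_support_function K h)"


section \<open>Differential calculus on the hyperboloid\<close>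

definition hyp_tangent :: "'d::finite mvec \<Rightarrow> 'd mvec set" where
  "hyp_tangent \<eta> = {v. mink v \<eta> = 0}"

text \<open>
  Maps on the embedded submanifold \<open>hyp\<close> are differentiated with \<open>at \<eta> within hyp\<close>. Such a
  derivative is a linear map on the whole ambient space, but only its restriction to
  \<open>hyp_tangent \<eta>\<close> is determined (lemma \<open>hyp_derivative_unique\<close> below); that restriction is the
  differential in the sense of manifolds. A map is \<open>C\<^sup>1\<close> iff some choice of these linear maps
  is continuous in \<open>\<eta>\<close>: composing the differential with the projection
  \<open>v \<mapsto> v + mink v \<eta> *\<^sub>R \<eta>\<close> onto the tangent space is such a choice.
\<close>

definition C1_on_hyp :: "('d::finite mvec \<Rightarrow> 'b::real_normed_vector) \<Rightarrow> bool" where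
  "C1_on_hyp F \<longleftrightarrow>
     (\<exists>F' :: 'd mvec \<Rightarrow> 'd mvec \<Rightarrow>\<^sub>L 'b.
        continuous_on hyp F' \<and>
        (\<forall>\<eta>\<in>hyp. (F has_derivative blinfun_apply (F' \<eta>)) (at \<eta> within hyp)))"

text \<open>
  The hyperbolic metric is the restriction of \<open>mink\<close> to the tangent spaces.
\<close>

definition hyp_grad :: "('d::finite mvec \<Rightarrow> real) \<Rightarrow> 'd mvec \<Rightarrow> 'd mvec" where
  "hyp_grad f \<eta> =
     (THE u. u \<in> hyp_tangent \<eta> \<and> (f has_derivative (\<lambda>v. mink u v)) (at \<eta> within hyp))"

definition C2_on_hyp :: "('d::finite mvec \<Rightarrow> real) \<Rightarrow> bool" where
  "C2_on_hyp f \<longleftrightarrow> C1_on_hyp f \<and> C1_on_hyp (hyp_grad f)"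

text \<open>
  The Levi-Civita derivative of the vector field \<open>hyp_grad f\<close> along \<open>v\<close> is the tangential part of its
  ambient derivative along \<open>v\<close>. The normal part is a multiple of \<open>\<eta>\<close>, which is orthogonal to tangent
  vectors, so pairing with a tangent vector \<open>w\<close> gives the Hessian. Only tangent \<open>v\<close>
  and \<open>w\<close> are meaningful arguments.
\<close>

definition hyp_hess :: "('d::finite mvec \<Rightarrow> real) \<Rightarrow> 'd mvec \<Rightarrow> 'd mvec \<Rightarrow> 'd mvec \<Rightarrow> real" where
  "hyp_hess f \<eta> v w = mink (frechet_derivative (hyp_grad f) (at \<eta> within hyp) v) w"

definition C2_plus :: "('d::finite mvec \<Rightarrow> real) \<Rightarrow> bool" where
  "C2_plus h \<longleftrightarrow> C2_on_hyp h \<and>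
     (\<forall>\<eta>\<in>hyp. \<forall>v\<in>hyp_tangent \<eta>. v \<noteq> 0 \<longrightarrow> hyp_hess h \<eta> v v - h \<eta> * mink v v > 0)"


section \<open>Well-definedness\<close>

lemma bilinear_mink: "bilinear (mink :: 'd::finite mvec \<Rightarrow> _)"
  unfolding bilinear_def mink_def
  by (auto intro!: linearI simp: algebra_simps sum.distrib sum_distrib_left)

lemmas mink_simps =
  bilinear_ladd[OF bilinear_mink] bilinear_radd[OF bilinear_mink]
  bilinear_lsub[OF bilinear_mink] bilinear_rsub[OF bilinear_mink]
  bilinear_lmul[OF bilinear_mink] bilinear_rmul[OF bilinear_mink]
  bilinear_lzero[OF bilinear_mink] bilinear_rzero[OF bilinear_mink]

lemma mink_commute: "mink X Y = mink Y X"
  by (simp add: mink_def mult.commute)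

lemma group_SO_plus: "group (SO_plus :: 'd::finite mmat monoid)"
proof (rule groupI, goal_cases)
  case (1 A B)
  have "(\<lambda>X. (A ** B) *v X) ` future_cone = ((*v) A) ` (((*v) B) ` future_cone)"
    by (simp add: image_image matrix_vector_mul_assoc)
  with 1 show ?case
    by (auto simp: SO_plus_def det_mul matrix_vector_mul_assoc[symmetric])
next
  case (5 A)
  hence A: "\<And>X Y. mink (A *v X) (A *v Y) = mink X Y" "det A > 0"
    "((*v) A) ` future_cone = future_cone"
    by (auto simp: SO_plus_def)
  obtain B where B: "A ** B = mat 1" "B ** A = mat 1"
    using A(2) by (metis invertible_def invertible_det_nz less_irrefl)
  have AB: "A *v (B *v X) = X" and BA: "B *v (A *v X) = X" for X
    by (simp_all add: matrix_vector_mul_assoc B)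
  have "mink (B *v X) (B *v Y) = mink X Y" for X Y
    using A(1)[of "B *v X" "B *v Y"] by (simp add: AB)
  moreover have "det B > 0"
    using det_mul[of A B] B A(2) by (metis det_I zero_less_mult_pos zero_less_one)
  moreover have "((*v) B) ` future_cone = future_cone"
  proof -
    have "((*v) B) ` (((*v) A) ` future_cone) = future_cone"
      by (simp add: image_image BA)
    thus ?thesis by (simp add: A(3))
  qed
  ultimately show ?case
    using B by (auto simp: SO_plus_def)
next
  case 2
  show ?case by (simp add: SO_plus_def)
next
  case (3 A B C)
  show ?case by (simp add: SO_plus_def matrix_mul_assoc)
next
  case (4 A)
  show ?case by (simp add: SO_plus_def)
qed

lemma openin_hyp_quotient:
  "openin (hyp_quotient \<Gamma>) U \<longleftrightarrow> U \<subseteq> hyp_orbits \<Gamma> \<and>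
     openin (top_of_set hyp) {x \<in> hyp. orbit (SO_plus\<lparr>carrier := \<Gamma>\<rparr>) (*v) x \<in> U}"
proof -
  let ?\<pi> = "orbit (SO_plus\<lparr>carrier := \<Gamma>\<rparr>) (*v)"
  have "openin (top_of_set hyp) {x \<in> hyp. ?\<pi> x \<in> S \<inter> T}"
    if "openin (top_of_set hyp) {x \<in> hyp. ?\<pi> x \<in> S}"
      "openin (top_of_set hyp) {x \<in> hyp. ?\<pi> x \<in> T}" for S T
  proof -
    have "{x \<in> hyp. ?\<pi> x \<in> S \<inter> T} = {x \<in> hyp. ?\<pi> x \<in> S} \<inter> {x \<in> hyp. ?\<pi> x \<in> T}"
      by blast
    thus ?thesis using openin_Int[OF that] by (simp only:)
  qed
  moreover have "openin (top_of_set hyp) {x \<in> hyp. ?\<pi> x \<in> \<Union>\<K>}"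
    if "\<And>S. S \<in> \<K> \<Longrightarrow> openin (top_of_set hyp) {x \<in> hyp. ?\<pi> x \<in> S}" for \<K>
  proof -
    have "{x \<in> hyp. ?\<pi> x \<in> \<Union>\<K>} = \<Union>((\<lambda>S. {x \<in> hyp. ?\<pi> x \<in> S}) ` \<K>)"
      by blast
    moreover have "openin (top_of_set hyp) (\<Union>((\<lambda>S. {x \<in> hyp. ?\<pi> x \<in> S}) ` \<K>))"
      using that by (intro openin_Union) blast
    ultimately show ?thesis by (simp only:)
  qed
  ultimately have "istopology (\<lambda>U. U \<subseteq> hyp_orbits \<Gamma> \<and> openin (top_of_set hyp) {x \<in> hyp. ?\<pi> x \<in> U})"
    unfolding istopology_def by (meson Sup_least le_infI1)
  thus ?thesis
    by (simp add: hyp_quotient_def topology_inverse')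
qed

lemma quotient_map_hyp_quotient:
  "quotient_map (top_of_set hyp) (hyp_quotient \<Gamma>) (orbit (SO_plus\<lparr>carrier := \<Gamma>\<rparr>) (*v))"
proof -
  let ?\<pi> = "orbit (SO_plus\<lparr>carrier := \<Gamma>\<rparr>) (*v)"
  have im: "?\<pi> ` hyp = hyp_orbits \<Gamma>"
    by (auto simp: hyp_orbits_def orbits_def)
  have "openin (hyp_quotient \<Gamma>) (hyp_orbits \<Gamma>)"
  proof -
    have "{x \<in> hyp. ?\<pi> x \<in> hyp_orbits \<Gamma>} = hyp" using im by auto
    thus ?thesis unfolding openin_hyp_quotient by simp
  qed
  hence "topspace (hyp_quotient \<Gamma>) = hyp_orbits \<Gamma>"
    by (meson openin_hyp_quotient openin_subset openin_topspace subset_antisym)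
  thus ?thesis
    by (auto simp: quotient_map_def openin_hyp_quotient im)
qed

lemma hyp_derivative_unique:
  fixes F :: "'d::finite mvec \<Rightarrow> 'b::real_normed_vector"
  assumes \<eta>: "\<eta> \<in> hyp" and v: "v \<in> hyp_tangent \<eta>"
    and F1: "(F has_derivative F1) (at \<eta> within hyp)"
    and F2: "(F has_derivative F2) (at \<eta> within hyp)"
  shows "F1 v = F2 v"
proof -
  define q where "q = mink v v"
  define c where "c = (\<lambda>t::real. sqrt (1 + t\<^sup>2 * q) *\<^sub>R \<eta> + t *\<^sub>R v)"
  define S where "S = {t. 1 + t\<^sup>2 * q > 0} \<inter> {t. c t $ None > 0}"
  have e: "mink \<eta> \<eta> = -1" "\<eta> $ None > 0" "mink v \<eta> = 0" "mink \<eta> v = 0"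
    using \<eta> v by (auto simp: hyp_def hyp_tangent_def mink_commute)
  have S: "open S"
    unfolding S_def c_def by (intro open_Int open_Collect_less continuous_intros)
  have S0: "0 \<in> S" and c0: "c 0 = \<eta>"
    using e by (auto simp: S_def c_def)
  have cS: "c ` S \<subseteq> hyp"
  proof
    fix x assume "x \<in> c ` S"
    then obtain t where t: "t \<in> S" "x = c t" by auto
    have "sqrt (1 + t\<^sup>2 * q) * sqrt (1 + t\<^sup>2 * q) = 1 + t\<^sup>2 * q"
      using t by (simp add: S_def)
    hence "mink (c t) (c t) = -1"
      by (simp add: c_def mink_simps e q_def power2_eq_square)
    thus "x \<in> hyp" using t by (simp add: hyp_def S_def)
  qed
  have "(c has_vector_derivative v) (at 0)"
    unfolding c_def by (auto intro!: derivative_eq_intros simp: has_vector_derivative_def)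
  hence c': "(c has_derivative (\<lambda>t. t *\<^sub>R v)) (at 0 within S)"
    by (simp add: has_vector_derivative_def has_derivative_at_withinI)
  have D: "(F \<circ> c has_vector_derivative G v) (at 0)"
    if "(F has_derivative G) (at \<eta> within hyp)" for G
  proof -
    have "(F has_derivative G) (at (c 0) within c ` S)"
      unfolding c0 using that cS by (rule has_derivative_subset)
    from diff_chain_within[OF c' this] have "(F \<circ> c has_derivative G \<circ> (\<lambda>t. t *\<^sub>R v)) (at 0)"
      unfolding at_within_open[OF S0 S] .
    moreover have "G \<circ> (\<lambda>t. t *\<^sub>R v) = (\<lambda>t. t *\<^sub>R G v)"
      using has_derivative_linear[OF that] by (auto simp: linear_scale)
    ultimately show ?thesis by (simp add: has_vector_derivative_def)
  qed
  show ?thesis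
    using D[OF F1] D[OF F2] by (rule vector_derivative_unique_at)
qed

end

theory Submission
  imports Defs
begin

text \<open>
  A \<open>\<tau>\<close>-convex set \<open>K\<close> carries a canonical \<open>\<Gamma>\<^sub>\<tau>\<close>-invariant measure, Lebesgue measure, because Lorentz
  maps have determinant one. Its support function is therefore smoothed equivariantly by the
  soft maximum over \<open>K\<close>, \<open>F\<^sub>N(\<eta>) = (1/N) log \<integral>\<^sub>K exp(N \<langle>p,\<eta>\<rangle>) dp\<close>,
  which is convex and smooth on the whole future cone, being a log-Laplace transform, and which
  satisfies \<open>F\<^sub>N(\<gamma>\<eta>) = F\<^sub>N(\<eta>) + \<langle>\<tau>\<^sub>\<gamma>, \<gamma>\<eta>\<rangle>\<close>, exactly as the support function \<open>h\<close> of \<open>K\<close> does. Hence \<open>F\<^sub>N - h\<close> is a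
  \<open>\<Gamma>\<close>-invariant function, and elementary Laplace bounds on a compact set of representatives give
  \<open>F\<^sub>N \<rightarrow> h\<close> uniformly on the hyperboloid (lemma \<open>soft_support_uniform\<close>).

  The function \<open>F\<^sub>N\<close> is not homogeneous, so the \<open>1\<close>-homogeneous extension of its restriction to the
  hyperboloid need not be convex: the tensor \<open>\<nabla>\<^sup>2F\<^sub>N - F\<^sub>N g\<close> equals the nonnegative Euclidean Hessian
  plus \<open>(dF\<^sub>N(\<eta>)\<eta> - F\<^sub>N(\<eta>)) g\<close>. The tangent inequality between \<open>\<eta>\<close> and \<open>\<eta>/2\<close> bounds
  the defect, \<open>F\<^sub>N(\<eta>) - dF\<^sub>N(\<eta>)\<eta> \<le> F\<^bsub>N/2\<^esub>(\<eta>) - F\<^sub>N(\<eta>)\<close>, and the right-hand side tends to \<open>0\<close> uniformly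
  (lemma \<open>mink_soft_point_ge\<close>). Subtracting a small constant \<open>\<epsilon>\<close> makes the tensor positive definite
  (lemma \<open>soft_support_C2_plus\<close>). The function \<open>F\<^sub>N - \<epsilon>\<close> is the support function of
  \<open>{p. \<forall>\<eta>. \<langle>p,\<eta>\<rangle> \<le> F\<^sub>N(\<eta>) - \<epsilon>}\<close>, because the point obtained by adding to the gradient of \<open>F\<^sub>N\<close> at \<open>\<eta>\<close>
  a suitable nonnegative multiple of \<open>\<eta>\<close> lies in this set and attains the bound at \<open>\<eta>\<close>
  (lemma \<open>soft_support_tau_support_function\<close>).
\<close>

section \<open>Linear maps preserving Lebesgue measure\<close>

lemma nn_integral_lborel_translate:
  fixes g :: "'a::euclidean_space \<Rightarrow> ennreal"
  assumes [measurable]: "g \<in> borel_measurable borel"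
  shows "(\<integral>\<^sup>+x. g (x + a) \<partial>lborel) = (\<integral>\<^sup>+x. g x \<partial>lborel)"
proof -
  have "(\<integral>\<^sup>+x. g x \<partial>lborel) = (\<integral>\<^sup>+x. g x \<partial>distr lborel borel ((+) a))"
    by (simp add: lborel_distr_plus)
  also have "\<dots> = (\<integral>\<^sup>+x. g (x + a) \<partial>lborel)"
    by (subst nn_integral_distr) (simp_all add: add.commute)
  finally show ?thesis ..
qed

text \<open>
  Both sides are the measure of pairs \<open>(x, y)\<close> with \<open>f x + y \<in> A\<close> and \<open>y \<in> B\<close>, integrated in
  the two orders. This is the usual argument for the uniqueness of Haar measure, applied to the image of
  Lebesgue measure under \<open>f\<close>: it shows that \<open>f\<close> scales all volumes by one factor, which can be read off
  any single set, and avoids determinants altogether.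
\<close>

lemma emeasure_linear_vimage_exchange:
  fixes f :: "'a::euclidean_space \<Rightarrow> 'a"
  assumes f: "linear f" "surj f" and A[measurable]: "A \<in> sets borel" and B[measurable]: "B \<in> sets borel"
  shows "emeasure lborel (f -` A) * emeasure lborel B
       = emeasure lborel A * emeasure lborel ((\<lambda>x. - f x) -` B)"
proof -
  have [measurable]: "f \<in> borel_measurable borel"
    using f(1) by (simp add: linear_continuous_on linear_conv_bounded_linear borel_measurable_continuous_onI)
  have shift: "(\<integral>\<^sup>+x. g (f x + y) \<partial>lborel) = (\<integral>\<^sup>+x. g (f x) \<partial>lborel)"
    if [measurable]: "g \<in> borel_measurable borel" for g :: "'a \<Rightarrow> ennreal" and y
  proof -
    obtain z where "f z = y" using f(2) by (metis surjD)
    then have "(\<integral>\<^sup>+x. g (f x + y) \<partial>lborel) = (\<integral>\<^sup>+x. g (f (x + z)) \<partial>lborel)"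
      using f(1) by (simp add: linear_add)
    then show ?thesis
      using nn_integral_lborel_translate[of "\<lambda>x. g (f x)" z] by simp
  qed
  have m[measurable]: "f -` A \<in> sets borel" "(\<lambda>x. - f x) -` B \<in> sets borel"
    using measurable_sets[of f borel borel A] measurable_sets[of "\<lambda>x. - f x" borel borel B] by simp_all
  have "emeasure lborel (f -` A) * emeasure lborel B
      = (\<integral>\<^sup>+y. (\<integral>\<^sup>+x. indicator A (f x) \<partial>lborel) * indicator B y \<partial>lborel)"
    by (simp add: nn_integral_cmult indicator_vimage[symmetric])
  also have "\<dots> = (\<integral>\<^sup>+y. (\<integral>\<^sup>+x. indicator A (f x + y) * indicator B y \<partial>lborel) \<partial>lborel)"
    by (simp add: nn_integral_multc shift[of "indicator A"])
  also have "\<dots> = (\<integral>\<^sup>+x. (\<integral>\<^sup>+y. indicator A (f x + y) * indicator B y \<partial>lborel) \<partial>lborel)"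
    by (rule lborel_pair.Fubini') measurable
  also have "\<dots> = (\<integral>\<^sup>+x. (\<integral>\<^sup>+y. indicator A y * indicator B (y - f x) \<partial>lborel) \<partial>lborel)"
  proof (rule nn_integral_cong)
    fix x
    show "(\<integral>\<^sup>+y. indicator A (f x + y) * indicator B y \<partial>lborel)
        = (\<integral>\<^sup>+y. indicator A y * (indicator B (y - f x)::ennreal) \<partial>lborel)"
      using nn_integral_lborel_translate[of "\<lambda>y. indicator A y * indicator B (y - f x)" "f x"]
      by (simp add: add.commute)
  qed
  also have "\<dots> = (\<integral>\<^sup>+y. (\<integral>\<^sup>+x. indicator A y * indicator B (y - f x) \<partial>lborel) \<partial>lborel)"
    by (rule lborel_pair.Fubini') measurable
  also have "\<dots> = (\<integral>\<^sup>+y. indicator A y * (\<integral>\<^sup>+x. indicator B (- f x) \<partial>lborel) \<partial>lborel)"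
    using shift[of "\<lambda>z. indicator B (- z)" "- _"] by (simp add: nn_integral_cmult)
  also have "\<dots> = emeasure lborel A * emeasure lborel ((\<lambda>x. - f x) -` B)"
    by (simp add: nn_integral_multc indicator_vimage[of "\<lambda>x. - f x", symmetric])
  finally show ?thesis .
qed

definition volume_preserving :: "('a::euclidean_space \<Rightarrow> 'a) \<Rightarrow> bool" where
  "volume_preserving f \<longleftrightarrow> f \<in> borel_measurable borel \<and> distr lborel borel f = lborel"

lemma volume_preserving_comp:
  assumes "volume_preserving f" "volume_preserving g"
  shows "volume_preserving (f \<circ> g)"
proof -
  have "distr lborel borel (f \<circ> g) = distr (distr lborel borel g) borel f"
    using assms by (subst distr_distr) (auto simp: volume_preserving_def)
  with assms show ?thesis by (auto simp: volume_preserving_def)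
qed

lemma emeasure_unit_ball:
  "emeasure lborel (ball 0 1 :: 'a::euclidean_space set) \<noteq> 0"
  "emeasure lborel (ball 0 1 :: 'a::euclidean_space set) \<noteq> \<infinity>"
  using content_ball_pos[of 1 "0::'a"] emeasure_lborel_ball_finite[of "0::'a" 1]
  by (auto simp: measure_def)

lemma volume_preserving_linearI:
  fixes f :: "'a::euclidean_space \<Rightarrow> 'a"
  assumes f: "linear f" "surj f" and eq: "emeasure lborel (f -` ball 0 1) = emeasure lborel (ball 0 1 :: 'a set)"
  shows "volume_preserving f"
proof -
  have m: "f \<in> borel_measurable borel"
    using f(1) by (simp add: linear_continuous_on linear_conv_bounded_linear borel_measurable_continuous_onI)
  have sym: "(\<lambda>x. - f x) -` ball 0 1 = f -` ball 0 1"
    by auto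
  have "distr lborel borel f = lborel"
  proof (rule measure_eqI)
    fix A :: "'a set" assume "A \<in> sets (distr lborel borel f)"
    then have A: "A \<in> sets borel" by simp
    have "emeasure lborel (f -` A) * emeasure lborel (ball 0 1 :: 'a set)
        = emeasure lborel A * emeasure lborel (ball 0 1 :: 'a set)"
      using emeasure_linear_vimage_exchange[OF f A, of "ball 0 1"] eq by (simp add: sym)
    then have "emeasure lborel (f -` A) = emeasure lborel A"
      using emeasure_unit_ball[where 'a='a]
      by (metis ennreal_mult_cancel_left infinity_ennreal_def mult.commute)
    then show "emeasure (distr lborel borel f) A = emeasure lborel A"
      using m A by (simp add: emeasure_distr)
  qed simp
  with m show ?thesis by (simp add: volume_preserving_def)
qed

lemma volume_preserving_isometry:
  assumes "linear f" "\<And>x. norm (f x) = norm x"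
  shows "volume_preserving f"
proof (rule volume_preserving_linearI)
  show "surj f"
    using assms orthogonal_transformation orthogonal_transformation_surj by blast
qed (use assms in \<open>auto simp: vimage_def intro!: arg_cong[where f="emeasure lborel"]\<close>)

text \<open>
  The volume factor of an involution is its own inverse. The unit ball is used because it is invariant
  under negation.
\<close>

lemma volume_preserving_involution:
  fixes f :: "'a::euclidean_space \<Rightarrow> 'a"
  assumes f: "linear f" "\<And>x. f (f x) = x"
  shows "volume_preserving f"
proof (rule volume_preserving_linearI)
  let ?B = "ball 0 1 :: 'a set"
  show s: "surj f" using f(2) by (metis surjI)
  have sym: "(\<lambda>x. - f x) -` ?B = f -` ?B" by auto
  have m: "f -` ?B \<in> sets borel"
    using f(1) by (intro measurable_sets_borel[of f borel]) (simp_all add: linear_continuous_on linear_conv_bounded_linear borel_measurable_continuous_onI)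
  have "emeasure lborel (f -` (f -` ?B)) * emeasure lborel ?B = emeasure lborel (f -` ?B) * emeasure lborel (f -` ?B)"
    using emeasure_linear_vimage_exchange[OF f(1) s m, of ?B] by (simp add: sym)
  moreover have "f -` (f -` ?B) = ?B" using f(2) by auto
  ultimately have sq: "emeasure lborel ?B * emeasure lborel ?B = emeasure lborel (f -` ?B) * emeasure lborel (f -` ?B)"
    by simp
  have square_eq: "a * b = b * b" if "b * b = a * a" for a b :: ennreal
  proof (cases "a \<le> b")
    case True
    then show ?thesis
      using mult_left_mono[of a b a] mult_right_mono[of a b b] that by (intro antisym) auto
  next
    case False
    then show ?thesis
      using mult_left_mono[of b a a] mult_right_mono[of b a b] that by (intro antisym) auto
  qed
  note square_eq[OF sq]
  then show "emeasure lborel (f -` ?B) = emeasure lborel ?B"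
    using emeasure_unit_ball[where 'a='a]
      by (metis ennreal_mult_cancel_left infinity_ennreal_def mult.commute)
qed (rule f(1))

section \<open>Laplace transforms of sets\<close>

lemma nn_integral_exp_neg_abs:
  fixes a :: real
  assumes "a > 0"
  shows "(\<integral>\<^sup>+x. ennreal (exp (- a * \<bar>x\<bar>)) \<partial>lborel) < \<infinity>"
proof -
  define g where "g = (\<lambda>x::real. ennreal (indicator {0..} x * exp (- a * x)))"
  have [measurable]: "g \<in> borel_measurable borel" by (simp add: g_def)
  have "((\<lambda>x. exp (- a * x)) has_integral exp (- a * 0) / a) {0..}"
    using has_integral_exp_minus_to_infinity[OF assms] .
  then have "((\<lambda>x. indicator {0..} x * exp (- a * x)) has_integral exp (- a * 0) / a) UNIV"
    by (subst (asm) has_integral_restrict_UNIV[symmetric])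
      (rule has_integral_eq[rotated], assumption, simp)
  then have fin: "(\<integral>\<^sup>+x. g x \<partial>lborel) < \<infinity>"
    unfolding g_def by (subst nn_integral_has_integral_lborel) auto
  have "(\<integral>\<^sup>+x. ennreal (exp (- a * \<bar>x\<bar>)) \<partial>lborel) \<le> (\<integral>\<^sup>+x. g x + g (- x) \<partial>lborel)"
  proof (rule nn_integral_mono)
    show "ennreal (exp (- a * \<bar>x\<bar>)) \<le> g x + g (- x)" for x
      by (cases "x \<ge> 0") (auto simp: g_def indicator_def)
  qed
  also have "\<dots> = (\<integral>\<^sup>+x. g x \<partial>lborel) + (\<integral>\<^sup>+x. g x \<partial>lborel)"
    using nn_integral_real_affine[of g "-1" 0] by (simp add: nn_integral_add)
  also have "\<dots> < \<infinity>"
    using fin by simp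
  finally show ?thesis .
qed

lemma integrable_exp_neg_norm:
  fixes c :: real
  assumes "c > 0"
  shows "integrable lborel (\<lambda>p::'a::euclidean_space. exp (- c * norm p))"
proof (rule integrableI_bounded)
  define a where "a = c / DIM('a)"
  have a: "a > 0" using assms by (simp add: a_def)
  have le: "exp (- c * norm p) \<le> (\<Prod>b\<in>Basis. exp (- a * \<bar>p \<bullet> b\<bar>))" for p :: 'a
  proof -
    have "(\<Sum>b\<in>(Basis::'a set). a * \<bar>p \<bullet> b\<bar>) \<le> (\<Sum>b\<in>(Basis::'a set). a * norm p)"
      using a by (intro sum_mono mult_left_mono) (auto simp: Basis_le_norm)
    also have "\<dots> = c * norm p" by (simp add: a_def)
    finally show ?thesis by (simp add: exp_sum[symmetric] sum_negf)
  qed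
  have "(\<integral>\<^sup>+p. ennreal (norm (exp (- c * norm (p::'a)))) \<partial>lborel)
      \<le> (\<integral>\<^sup>+p. (\<Prod>b\<in>Basis. ennreal (exp (- a * \<bar>(p::'a) \<bullet> b\<bar>))) \<partial>lborel)"
    using le by (intro nn_integral_mono) (simp add: prod_ennreal ennreal_leI)
  also have "\<dots> = (\<Prod>b\<in>(Basis::'a set). (\<integral>\<^sup>+x. ennreal (exp (- a * \<bar>x\<bar>)) \<partial>lborel))"
    by (rule nn_integral_lborel_prod) auto
  also have "\<dots> < \<infinity>"
    using nn_integral_exp_neg_abs[OF a] by (simp add: power_less_top_ennreal)
  finally show "(\<integral>\<^sup>+p. ennreal (norm (exp (- c * norm (p::'a)))) \<partial>lborel) < \<infinity>" .
qed simp

text \<open>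
  The interior of the barrier cone of \<open>K\<close>, in the quantitative form needed for integration.
\<close>

definition decay_set :: "'a::euclidean_space set \<Rightarrow> 'a set" where
  "decay_set K = {x. \<exists>c>0. \<exists>A. \<forall>p\<in>K. p \<bullet> x \<le> A - c * norm p}"

text \<open>
  A ball around \<open>x\<close> contains a cross-polytope centred at \<open>x\<close>; the bounds in the directions of its
  finitely many vertices add up to linear decay.
\<close>

lemma decay_setI:
  fixes K :: "'a::euclidean_space set"
  assumes "open S" "x \<in> S" and bdd: "\<And>y. y \<in> S \<Longrightarrow> bdd_above ((\<lambda>p. p \<bullet> y) ` K)"
  shows "x \<in> decay_set K"
proof -
  obtain r where r: "r > 0" "cball x r \<subseteq> S"
    using assms(1,2) open_contains_cball by blast
  define B where "B = (Basis \<union> uminus ` Basis :: 'a set)"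
  have "\<exists>M. \<forall>p\<in>K. p \<bullet> (x + r *\<^sub>R b) \<le> M" if "b \<in> B" for b
  proof -
    have "x + r *\<^sub>R b \<in> cball x r"
      using that r(1) by (auto simp: B_def dist_norm)
    then show ?thesis using bdd r(2) by (fastforce simp: bdd_above_def)
  qed
  then obtain M where M: "\<And>b p. b \<in> B \<Longrightarrow> p \<in> K \<Longrightarrow> p \<bullet> (x + r *\<^sub>R b) \<le> M b"
    by metis
  have fin: "finite B" by (simp add: B_def)
  define A where "A = Max (M ` B)"
  have A: "p \<bullet> x + r * (p \<bullet> b) \<le> A" if "b \<in> B" "p \<in> K" for b p
  proof -
    have "M b \<le> A" using fin that by (simp add: A_def)
    with M[OF that] show ?thesis by (simp add: inner_add_right)
  qed
  have "p \<bullet> x \<le> A - r / DIM('a) * norm p" if "p \<in> K" for p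
  proof -
    have "r * \<bar>p \<bullet> b\<bar> \<le> A - p \<bullet> x" if "b \<in> Basis" for b
      using A[of b p] A[of "- b" p] that \<open>p \<in> K\<close> by (auto simp: B_def abs_if)
    then have "(\<Sum>b\<in>(Basis::'a set). r * \<bar>p \<bullet> b\<bar>) \<le> (\<Sum>b\<in>(Basis::'a set). A - p \<bullet> x)"
      by (intro sum_mono)
    then have "r * (\<Sum>b\<in>(Basis::'a set). \<bar>p \<bullet> b\<bar>) \<le> DIM('a) * (A - p \<bullet> x)"
      by (simp add: sum_distrib_left)
    moreover have "r * norm p \<le> r * (\<Sum>b\<in>(Basis::'a set). \<bar>p \<bullet> b\<bar>)"
      using norm_le_l1[of p] r(1) by simp
    ultimately show ?thesis
      by (simp add: field_simps)
  qed
  then show ?thesis using r(1) unfolding decay_set_def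
    by (intro CollectI exI[of _ "r / DIM('a)"] conjI exI[of _ A]) auto
qed

text \<open>
  The weights for which the Laplace integral converges on the whole decay set. They are closed under
  multiplication with linear forms, hence under differentiation of the transform.
\<close>

definition subexponential :: "('a::euclidean_space \<Rightarrow> 'b::real_normed_vector) \<Rightarrow> bool" where
  "subexponential u \<longleftrightarrow> u \<in> borel_measurable borel \<and>
     (\<forall>r>0. \<exists>C. \<forall>p. norm (u p) \<le> C * exp (r * norm p))"

lemma subexponentialE:
  assumes "subexponential u" "r > 0"
  obtains C where "C \<ge> 0" "\<And>p. norm (u p) \<le> C * exp (r * norm p)"
proof -
  obtain C where "\<And>p. norm (u p) \<le> C * exp (r * norm p)"
    using assms by (auto simp: subexponential_def)
  moreover from this[of 0] have "C \<ge> 0" using order_trans[OF norm_ge_zero] by fastforce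
  ultimately show ?thesis using that by blast
qed

lemma subexponential_const [simp]: "subexponential (\<lambda>_. a)"
  unfolding subexponential_def
  by (auto intro!: exI[of _ "norm a"] mult_right_le_one_le simp: mult_le_cancel_left1)

lemma subexponential_inner_scaleR:
  fixes u :: "'a::euclidean_space \<Rightarrow> 'b::{real_normed_vector, second_countable_topology}"
  assumes u: "subexponential u"
  shows "subexponential (\<lambda>p. (p \<bullet> v) *\<^sub>R u p)"
  unfolding subexponential_def
proof (intro conjI allI impI)
  have [measurable]: "u \<in> borel_measurable borel"
    using u by (simp add: subexponential_def)
  show "(\<lambda>p. (p \<bullet> v) *\<^sub>R u p) \<in> borel_measurable borel"
    by measurable
  fix r :: real assume r: "r > 0"
  then obtain C where C: "C \<ge> 0" "\<And>p. norm (u p) \<le> C * exp (r / 2 * norm p)"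
    using subexponentialE[OF u, of "r/2"] by auto
  have "norm ((p \<bullet> v) *\<^sub>R u p) \<le> 2 / r * norm v * C * exp (r * norm p)" for p
  proof -
    have "r / 2 * norm p \<le> exp (r / 2 * norm p)"
      using exp_ge_add_one_self[of "r / 2 * norm p"] by linarith
    then have "norm p \<le> 2 / r * exp (r / 2 * norm p)"
      using r by (simp add: field_simps)
    then have "\<bar>p \<bullet> v\<bar> \<le> 2 / r * exp (r / 2 * norm p) * norm v"
      using Cauchy_Schwarz_ineq2[of p v] by (meson mult_right_mono norm_ge_zero order_trans)
    then have "norm ((p \<bullet> v) *\<^sub>R u p) \<le> (2 / r * exp (r / 2 * norm p) * norm v) * (C * exp (r / 2 * norm p))"
      unfolding norm_scaleR real_norm_def using C(2)[of p] r by (intro mult_mono) auto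
    also have "\<dots> = 2 / r * norm v * C * exp (r * norm p)"
      by (simp add: exp_add[symmetric])
    finally show ?thesis .
  qed
  then show "\<exists>C. \<forall>p. norm ((p \<bullet> v) *\<^sub>R u p) \<le> C * exp (r * norm p)" by blast
qed

lemma subexponential_id: "subexponential (\<lambda>p::'a::euclidean_space. p)"
  unfolding subexponential_def
proof (intro conjI allI impI)
  fix r :: real assume r: "r > 0"
  have "norm (p::'a) \<le> 1 / r * exp (r * norm p)" for p
  proof -
    have "r * norm p \<le> exp (r * norm p)"
      using exp_ge_add_one_self[of "r * norm p"] by linarith
    then show ?thesis using r by (simp add: field_simps)
  qed
  then show "\<exists>C. \<forall>p::'a. norm p \<le> C * exp (r * norm p)" by blast
qed simp

definition laplace ::
    "'a::euclidean_space set \<Rightarrow> ('a \<Rightarrow> 'b::{banach, second_countable_topology}) \<Rightarrow> 'a \<Rightarrow> 'b" where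
  "laplace K u x = (LINT p:K|lborel. exp (p \<bullet> x) *\<^sub>R u p)"

lemma laplace_integrable:
  fixes u :: "'a::euclidean_space \<Rightarrow> 'b::{banach, second_countable_topology}"
  assumes K: "K \<in> sets borel" and x: "x \<in> decay_set K" and u: "subexponential u"
  shows "set_integrable lborel K (\<lambda>p. exp (p \<bullet> x) *\<^sub>R u p)"
proof -
  obtain c A where c: "c > 0" and A: "\<And>p. p \<in> K \<Longrightarrow> p \<bullet> x \<le> A - c * norm p"
    using x by (auto simp: decay_set_def)
  obtain C where C: "C \<ge> 0" "\<And>p. norm (u p) \<le> C * exp (c / 2 * norm p)"
    using subexponentialE[OF u, of "c/2"] c by auto
  have [measurable]: "u \<in> borel_measurable borel" "K \<in> sets borel"
    using u K by (auto simp: subexponential_def)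
  show ?thesis unfolding set_integrable_def
  proof (rule Bochner_Integration.integrable_bound)
    show "integrable lborel (\<lambda>p. C * exp A * exp (- (c / 2) * norm p))"
      using integrable_exp_neg_norm[of "c/2"] c by (intro integrable_mult_right) auto
    have "norm (exp (p \<bullet> x) *\<^sub>R u p) \<le> C * exp A * exp (- (c / 2) * norm p)" if "p \<in> K" for p
    proof -
      have "norm (exp (p \<bullet> x) *\<^sub>R u p) \<le> exp (A - c * norm p) * (C * exp (c / 2 * norm p))"
        using A[OF that] C by (simp, intro mult_mono) auto
      also have "\<dots> = C * exp A * exp (- (c / 2) * norm p)"
        by (simp add: exp_add[symmetric] exp_diff[symmetric] field_simps)
      finally show ?thesis .
    qed
    then show "AE p in lborel. norm (indicat_real K p *\<^sub>R exp (p \<bullet> x) *\<^sub>R u p)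
        \<le> norm (C * exp A * exp (- (c / 2) * norm p))"
      using C(1) by (auto simp: indicator_def)
  qed measurable
qed

lemma exp_quadratic_remainder:
  fixes t :: real
  shows "\<bar>exp t - 1 - t\<bar> \<le> t\<^sup>2 * exp \<bar>t\<bar>"
proof -
  obtain s where s: "\<bar>s\<bar> \<le> \<bar>t\<bar>" "exp t = (\<Sum>m<2. t ^ m / fact m) + exp s / fact 2 * t ^ 2"
    using Maclaurin_exp_le by blast
  then have "exp t - 1 - t = exp s / 2 * t\<^sup>2"
    by (simp add: numeral_2_eq_2)
  moreover have "exp s / 2 * t\<^sup>2 \<le> exp \<bar>t\<bar> * t\<^sup>2"
  proof (rule mult_right_mono)
    have "exp s \<le> exp \<bar>t\<bar>" using s(1) by simp
    moreover have "exp s > 0" by simp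
    ultimately show "exp s / 2 \<le> exp \<bar>t\<bar>" by linarith
  qed simp
  moreover have "0 \<le> exp s / 2 * t\<^sup>2" by simp
  ultimately show ?thesis by (simp only: mult.commute abs_of_nonneg)
qed

lemma has_derivative_quadratic_remainderI:
  fixes f :: "'a::real_normed_vector \<Rightarrow> 'b::real_normed_vector"
  assumes "bounded_linear D" "r > 0"
    and rem: "\<And>v. norm v < r \<Longrightarrow> norm (f (x + v) - f x - D v) \<le> B * (norm v)\<^sup>2"
  shows "(f has_derivative D) (at x)"
  unfolding has_derivative_at
proof (intro conjI)
  show "(\<lambda>h. norm (f (x + h) - f x - D h) / norm h) \<midarrow>0\<rightarrow> 0"
  proof (rule Lim_null_comparison)
    show "\<forall>\<^sub>F h in at 0. norm (norm (f (x + h) - f x - D h) / norm h) \<le> B * norm h"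
      unfolding eventually_at
    proof (intro exI[of _ r] conjI ballI impI)
      fix h :: 'a assume "h \<noteq> 0 \<and> dist h 0 < r"
      then show "norm (norm (f (x + h) - f x - D h) / norm h) \<le> B * norm h"
        using rem[of h] by (simp add: divide_simps power2_eq_square mult.assoc)
    qed (rule assms(2))
    show "(\<lambda>h. B * norm h) \<midarrow>0\<rightarrow> 0"
      by (auto intro!: tendsto_eq_intros)
  qed
qed (rule assms(1))

text \<open>
  The remainder of the exponential is bounded by an integrable function times the square of the
  increment, so differentiation under the integral needs no limit theorem. With weights of the form
  \<open>(p \<bullet> v) *\<^sub>R u p\<close> the same lemma yields all higher derivatives and their continuity.
\<close>

lemma laplace_has_derivative:
  fixes u :: "'a::euclidean_space \<Rightarrow> 'b::{banach, second_countable_topology}"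
  assumes K: "K \<in> sets borel" and x: "x \<in> decay_set K" and u: "subexponential u"
  shows "(laplace K u has_derivative (\<lambda>v. laplace K (\<lambda>p. (p \<bullet> v) *\<^sub>R u p) x)) (at x)"
proof -
  obtain c A where c: "c > 0" and A: "\<And>p. p \<in> K \<Longrightarrow> p \<bullet> x \<le> A - c * norm p"
    using x by (auto simp: decay_set_def)
  have near: "x + v \<in> decay_set K" if v: "norm v < c / 4" for v
  proof -
    have "p \<bullet> (x + v) \<le> A - c / 2 * norm p" if p: "p \<in> K" for p
    proof -
      have "p \<bullet> v \<le> norm p * norm v" by (rule norm_cauchy_schwarz)
      also have "\<dots> \<le> norm p * (c / 4)" using v by (intro mult_left_mono) auto
      finally have "p \<bullet> v \<le> c / 4 * norm p" by (simp add: mult.commute)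
      moreover have "0 \<le> c * norm p" using c by simp
      ultimately show ?thesis using A[OF p] by (simp add: inner_add_right)
    qed
    then show ?thesis using c unfolding decay_set_def
      by (intro CollectI exI[of _ "c/2"] conjI exI[of _ A]) auto
  qed
  note int = laplace_integrable[OF K]
  note intd = int[OF x subexponential_inner_scaleR[OF u]]
  \<comment> \<open>A quarter of the decay rate \<open>c\<close> is spent on each of \<open>u\<close>, the square of \<open>norm p\<close> and the increment \<open>v\<close>; one quarter is left for integrability.\<close>
  obtain C where C: "C \<ge> 0" "\<And>p. norm (u p) \<le> C * exp (c / 4 * norm p)"
    using subexponentialE[OF u, of "c/4"] c by auto
  have sq: "(norm p)\<^sup>2 \<le> (8 / c)\<^sup>2 * exp (c / 4 * norm p)" for p :: 'a
  proof -
    have "c / 8 * norm p \<le> exp (c / 8 * norm p)"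
      using exp_ge_add_one_self[of "c / 8 * norm p"] by linarith
    then have "norm p \<le> 8 / c * exp (c / 8 * norm p)"
      using c by (simp add: field_simps)
    then have "(norm p)\<^sup>2 \<le> (8 / c * exp (c / 8 * norm p))\<^sup>2"
      by (rule power_mono) simp
    also have "\<dots> = (8 / c)\<^sup>2 * exp (c / 4 * norm p)"
      by (simp add: power_mult_distrib power_divide exp_double[symmetric])
    finally show ?thesis .
  qed
  define M where "M = (8 / c)\<^sup>2 * C * exp A"
  define B where "B = (\<integral>p. M * exp (- (c / 4) * norm (p::'a)) \<partial>lborel)"
  have iM: "integrable lborel (\<lambda>p::'a. M * exp (- (c / 4) * norm p))"
    using integrable_exp_neg_norm[of "c/4"] c by (intro integrable_mult_right) auto
  show ?thesis
  proof (rule has_derivative_quadratic_remainderI)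
    have "linear (\<lambda>v. laplace K (\<lambda>p. (p \<bullet> v) *\<^sub>R u p) x)"
    proof (rule linearI)
      fix v w
      show "laplace K (\<lambda>p. (p \<bullet> (v + w)) *\<^sub>R u p) x
          = laplace K (\<lambda>p. (p \<bullet> v) *\<^sub>R u p) x + laplace K (\<lambda>p. (p \<bullet> w) *\<^sub>R u p) x"
        unfolding laplace_def
        by (subst set_integral_add(2)[OF intd intd, symmetric])
          (simp add: inner_add_right algebra_simps)
    next
      fix r v
      show "laplace K (\<lambda>p. (p \<bullet> (r *\<^sub>R v)) *\<^sub>R u p) x = r *\<^sub>R laplace K (\<lambda>p. (p \<bullet> v) *\<^sub>R u p) x"
        unfolding laplace_def
        by (subst set_integral_scaleR_right[symmetric]) (simp add: mult_ac)
    qed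
    then show "bounded_linear (\<lambda>v. laplace K (\<lambda>p. (p \<bullet> v) *\<^sub>R u p) x)"
      by (simp add: linear_conv_bounded_linear)
    show "c / 4 > 0" using c by simp
    fix v :: 'a assume v: "norm v < c / 4"
    let ?R = "\<lambda>p. exp (p \<bullet> (x + v)) *\<^sub>R u p - exp (p \<bullet> x) *\<^sub>R u p - exp (p \<bullet> x) *\<^sub>R (p \<bullet> v) *\<^sub>R u p"
    have "laplace K u (x + v) - laplace K u x - laplace K (\<lambda>p. (p \<bullet> v) *\<^sub>R u p) x
        = (LINT p:K|lborel. ?R p)"
      unfolding laplace_def
      using set_integral_diff(2)[OF set_integral_diff(1)[OF int[OF near[OF v] u] int[OF x u]] intd]
        set_integral_diff(2)[OF int[OF near[OF v] u] int[OF x u]] by simp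
    also have "norm \<dots> \<le> (\<integral>p. (norm v)\<^sup>2 * (M * exp (- (c / 4) * norm (p::'a))) \<partial>lborel)"
      unfolding set_lebesgue_integral_def
    proof (rule Bochner_Integration.integral_norm_bound_integral)
      show "integrable lborel (\<lambda>p. indicat_real K p *\<^sub>R ?R p)"
        using set_integral_diff(1)[OF set_integral_diff(1)[OF int[OF near[OF v] u] int[OF x u]] intd]
        by (simp add: set_integrable_def)
      show "integrable lborel (\<lambda>p. (norm v)\<^sup>2 * (M * exp (- (c / 4) * norm (p::'a))))"
        using iM by (intro integrable_mult_right) auto
      have "norm (?R p) \<le> (norm v)\<^sup>2 * (M * exp (- (c / 4) * norm p))" if p: "p \<in> K" for p
      proof -
        have pv: "\<bar>p \<bullet> v\<bar> \<le> norm p * norm v" by (rule Cauchy_Schwarz_ineq2)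
        have pv': "\<bar>p \<bullet> v\<bar> \<le> c / 4 * norm p"
          using pv v mult_left_mono[of "norm v" "c/4" "norm p"] by (simp add: mult.commute)
        have "?R p = (exp (p \<bullet> x) * (exp (p \<bullet> v) - 1 - p \<bullet> v)) *\<^sub>R u p"
          by (simp add: inner_add_right exp_add algebra_simps)
        then have "norm (?R p) = exp (p \<bullet> x) * \<bar>exp (p \<bullet> v) - 1 - p \<bullet> v\<bar> * norm (u p)"
          by (simp add: abs_mult)
        also have "\<dots> \<le> exp (A - c * norm p) * ((norm v)\<^sup>2 * ((8 / c)\<^sup>2 * exp (c / 4 * norm p)) * exp (c / 4 * norm p))
            * (C * exp (c / 4 * norm p))"
        proof (intro mult_mono)
          show "exp (p \<bullet> x) \<le> exp (A - c * norm p)" using A[OF p] by simp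
          have "(p \<bullet> v)\<^sup>2 \<le> (norm p * norm v)\<^sup>2"
            using pv abs_le_square_iff[of "p \<bullet> v" "norm p * norm v"] by simp
          also have "\<dots> \<le> (norm v)\<^sup>2 * ((8 / c)\<^sup>2 * exp (c / 4 * norm p))"
            using mult_left_mono[OF sq[of p], of "(norm v)\<^sup>2"]
            by (simp add: power_mult_distrib mult.commute)
          finally have "(p \<bullet> v)\<^sup>2 * exp \<bar>p \<bullet> v\<bar> \<le> (norm v)\<^sup>2 * ((8 / c)\<^sup>2 * exp (c / 4 * norm p)) * exp (c / 4 * norm p)"
            using pv' by (intro mult_mono) auto
          then show "\<bar>exp (p \<bullet> v) - 1 - p \<bullet> v\<bar> \<le> (norm v)\<^sup>2 * ((8 / c)\<^sup>2 * exp (c / 4 * norm p)) * exp (c / 4 * norm p)"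
            using exp_quadratic_remainder[of "p \<bullet> v"] by linarith
        qed (use C in auto)
        also have "\<dots> = (norm v)\<^sup>2 * (M * (exp (- c * norm p) * exp (c / 4 * norm p) * exp (c / 4 * norm p) * exp (c / 4 * norm p)))"
          by (simp add: M_def exp_diff exp_minus field_simps)
        also have "exp (- c * norm p) * exp (c / 4 * norm p) * exp (c / 4 * norm p) * exp (c / 4 * norm p)
            = exp (- (c / 4) * norm p)"
          by (simp add: exp_add[symmetric])
        finally show ?thesis .
      qed
      moreover have "0 \<le> (norm v)\<^sup>2 * (M * exp (- (c / 4) * norm p))" for p :: 'a
        using C(1) by (simp add: M_def)
      ultimately show "norm (indicat_real K p *\<^sub>R ?R p) \<le> (norm v)\<^sup>2 * (M * exp (- (c / 4) * norm p))" for p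
        by (cases "p \<in> K") auto
    qed
    also have "\<dots> = B * (norm v)\<^sup>2"
      by (simp add: B_def)
    finally show "norm (laplace K u (x + v) - laplace K u x - laplace K (\<lambda>p. (p \<bullet> v) *\<^sub>R u p) x)
        \<le> B * (norm v)\<^sup>2" .
  qed
qed

section \<open>The log-Laplace transform\<close>

definition mass :: "'a::euclidean_space set \<Rightarrow> 'a \<Rightarrow> real" where
  "mass K = laplace K (\<lambda>_. 1)"

definition log_laplace :: "'a::euclidean_space set \<Rightarrow> 'a \<Rightarrow> real" where
  "log_laplace K x = ln (mass K x)"

text \<open>
  Mean and covariance of the probability measure on \<open>K\<close> with density proportional to
  \<open>exp (p \<bullet> x)\<close>: the gradient and the Hessian of the log-Laplace transform.
\<close>

definition tilted_mean :: "'a::euclidean_space set \<Rightarrow> 'a \<Rightarrow> 'a" where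
  "tilted_mean K x = laplace K (\<lambda>p. p) x /\<^sub>R mass K x"

definition tilted_cov :: "'a::euclidean_space set \<Rightarrow> 'a \<Rightarrow> 'a \<Rightarrow> 'a" where
  "tilted_cov K x v = laplace K (\<lambda>p. (p \<bullet> v) *\<^sub>R p) x /\<^sub>R mass K x
                    - (tilted_mean K x \<bullet> v) *\<^sub>R tilted_mean K x"

lemma laplace_inner:
  fixes u :: "'a::euclidean_space \<Rightarrow> 'a"
  assumes "K \<in> sets borel" "x \<in> decay_set K" "subexponential u"
  shows "laplace K u x \<bullet> v = (LINT p:K|lborel. exp (p \<bullet> x) * (u p \<bullet> v))"
  using laplace_integrable[OF assms]
  by (simp add: laplace_def set_lebesgue_integral_def set_integrable_def mult.assoc flip: integral_inner_left)

text \<open>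
  A nonempty interior makes the Laplace transform positive, so that its logarithm is differentiable.
\<close>

locale laplace_domain =
  fixes K :: "'a::euclidean_space set"
  assumes borel: "K \<in> sets borel" and interior: "interior K \<noteq> {}"
begin

lemma mass_pos:
  assumes x: "x \<in> decay_set K"
  shows "mass K x > 0"
proof -
  have int: "integrable lborel (\<lambda>p. indicator K p * exp (p \<bullet> x))"
    using laplace_integrable[OF borel x subexponential_const[of "1::real"]]
    by (simp add: set_integrable_def)
  have eq: "mass K x = (\<integral>p. indicator K p * exp (p \<bullet> x) \<partial>lborel)"
    by (simp add: mass_def laplace_def set_lebesgue_integral_def)
  have "mass K x \<noteq> 0"
  proof
    assume "mass K x = 0"
    then have "AE p in lborel. indicator K p * exp (p \<bullet> x) = 0"
      using integral_nonneg_eq_0_iff_AE[OF int] by (simp add: eq)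
    then have "AE p in lborel. p \<notin> interior K"
      by (rule AE_mp) (use interior_subset in \<open>auto simp: indicator_def\<close>)
    then have "interior K = {}"
      by (metis AE_iff_null_sets borel_open negligible_iff_null_sets null_sets_completionI
          open_interior open_not_negligible sets_lborel)
    with interior show False ..
  qed
  moreover have "mass K x \<ge> 0"
    unfolding eq by (rule Bochner_Integration.integral_nonneg) simp
  ultimately show ?thesis by simp
qed

lemma log_laplace_has_derivative:
  assumes x: "x \<in> decay_set K"
  shows "(log_laplace K has_derivative (\<lambda>v. tilted_mean K x \<bullet> v)) (at x)"
proof -
  have "(mass K has_derivative (\<lambda>v. laplace K (\<lambda>p. (p \<bullet> v) *\<^sub>R 1) x)) (at x)"
    unfolding mass_def by (rule laplace_has_derivative[OF borel x]) simp
  then have "(log_laplace K has_derivative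
      (\<lambda>v. laplace K (\<lambda>p. (p \<bullet> v) *\<^sub>R 1) x * inverse (mass K x))) (at x)"
    unfolding log_laplace_def[abs_def] using mass_pos[OF x]
    by (auto intro!: derivative_eq_intros)
  also have "(\<lambda>v. laplace K (\<lambda>p. (p \<bullet> v) *\<^sub>R 1) x * inverse (mass K x)) = (\<lambda>v. tilted_mean K x \<bullet> v)"
    using laplace_inner[OF borel x subexponential_id]
    by (simp add: tilted_mean_def laplace_def fun_eq_iff)
  finally show ?thesis .
qed

lemma tilted_mean_has_derivative:
  assumes x: "x \<in> decay_set K"
  shows "(tilted_mean K has_derivative tilted_cov K x) (at x)"
proof -
  have 0: "(mass K has_derivative (\<lambda>v. laplace K (\<lambda>p. (p \<bullet> v) *\<^sub>R 1) x)) (at x)"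
    unfolding mass_def by (rule laplace_has_derivative[OF borel x]) simp
  have 1: "(laplace K (\<lambda>p. p) has_derivative (\<lambda>v. laplace K (\<lambda>p. (p \<bullet> v) *\<^sub>R p) x)) (at x)"
    by (rule laplace_has_derivative[OF borel x subexponential_id])
  have "mass K x \<noteq> 0" using mass_pos[OF x] by simp
  have d: "laplace K (\<lambda>p. (p \<bullet> v) *\<^sub>R 1) x = laplace K (\<lambda>p. p) x \<bullet> v" for v
    using laplace_inner[OF borel x subexponential_id] by (simp add: laplace_def)
  have "((\<lambda>y. inverse (mass K y) *\<^sub>R laplace K (\<lambda>p. p) y) has_derivative
      (\<lambda>v. inverse (mass K x) *\<^sub>R laplace K (\<lambda>p. (p \<bullet> v) *\<^sub>R p) x
         + (- (inverse (mass K x) * laplace K (\<lambda>p. (p \<bullet> v) *\<^sub>R 1) x * inverse (mass K x)))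
              *\<^sub>R laplace K (\<lambda>p. p) x)) (at x)"
    by (rule has_derivative_scaleR[OF Deriv.has_derivative_inverse[OF \<open>mass K x \<noteq> 0\<close> 0] 1])
  also have "(\<lambda>v. inverse (mass K x) *\<^sub>R laplace K (\<lambda>p. (p \<bullet> v) *\<^sub>R p) x
         + (- (inverse (mass K x) * laplace K (\<lambda>p. (p \<bullet> v) *\<^sub>R 1) x * inverse (mass K x)))
              *\<^sub>R laplace K (\<lambda>p. p) x) = tilted_cov K x"
    unfolding d by (simp add: fun_eq_iff tilted_cov_def tilted_mean_def mult_ac)
  finally show ?thesis
    by (simp add: tilted_mean_def[abs_def])
qed

lemma continuous_on_laplace:
  fixes u :: "'a \<Rightarrow> 'b::{banach, second_countable_topology}"
  assumes "subexponential u"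
  shows "continuous_on (decay_set K) (laplace K u)"
  using laplace_has_derivative[OF borel _ assms] has_derivative_continuous
    continuous_at_imp_continuous_on by blast

lemma continuous_on_tilted_cov: "continuous_on (decay_set K) (\<lambda>x. tilted_cov K x v)"
proof -
  have [continuous_intros]: "continuous_on (decay_set K) (mass K)"
    unfolding mass_def by (rule continuous_on_laplace) simp
  have "mass K x \<noteq> 0" if "x \<in> decay_set K" for x
    using mass_pos[OF that] by simp
  then show ?thesis
    unfolding tilted_cov_def tilted_mean_def
    by (intro continuous_intros continuous_on_laplace subexponential_inner_scaleR subexponential_id) auto
qed

text \<open>
  Convexity, as Jensen's inequality for the tilted measure: bound the exponential from below by its
  tangent at the mean.
\<close>

lemma log_laplace_tangent:
  assumes x: "x \<in> decay_set K" and y: "y \<in> decay_set K"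
  shows "log_laplace K x + tilted_mean K x \<bullet> (y - x) \<le> log_laplace K y"
proof -
  define m where "m = tilted_mean K x \<bullet> (y - x)"
  note c = subexponential_const[of "1::real"]
  have i0: "set_integrable lborel K (\<lambda>p. exp (p \<bullet> z))" if "z \<in> decay_set K" for z
    using laplace_integrable[OF borel that c] by simp
  have i1: "set_integrable lborel K (\<lambda>p. exp (p \<bullet> x) * (p \<bullet> (y - x)))"
    using laplace_integrable[OF borel x subexponential_inner_scaleR[OF c, of "y - x"]] by simp
  have m0: "mass K z = (LINT p:K|lborel. exp (p \<bullet> z))" for z
    by (simp add: mass_def laplace_def)
  have m1: "(LINT p:K|lborel. exp (p \<bullet> x) * (p \<bullet> (y - x))) = mass K x * m"
    using mass_pos[OF x] laplace_inner[OF borel x subexponential_id, of "y - x"]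
    by (simp add: m_def tilted_mean_def)
  have "exp m * mass K x = exp m * ((1 - m) * mass K x + mass K x * m)"
    by (simp add: algebra_simps)
  also have "\<dots> = (LINT p:K|lborel. exp m * ((1 - m) * exp (p \<bullet> x) + exp (p \<bullet> x) * (p \<bullet> (y - x))))"
    using i0[OF x] i1 by (simp add: set_integral_add m0 m1)
  also have "\<dots> \<le> (LINT p:K|lborel. exp (p \<bullet> y))"
  proof (rule set_integral_mono)
    show "set_integrable lborel K (\<lambda>p. exp m * ((1 - m) * exp (p \<bullet> x) + exp (p \<bullet> x) * (p \<bullet> (y - x))))"
      using i0[OF x] i1 by (intro set_integrable_mult_right set_integral_add(1)) auto
    fix p
    have "exp m * ((1 - m) * exp (p \<bullet> x) + exp (p \<bullet> x) * (p \<bullet> (y - x)))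
        = exp m * exp (p \<bullet> x) * (1 + (p \<bullet> (y - x) - m))"
      by (simp add: algebra_simps)
    also have "\<dots> \<le> exp m * exp (p \<bullet> x) * exp (p \<bullet> (y - x) - m)"
      by (intro mult_left_mono exp_ge_add_one_self) auto
    also have "\<dots> = exp (p \<bullet> y)"
      by (simp add: exp_add[symmetric] inner_diff_right)
    finally show "exp m * ((1 - m) * exp (p \<bullet> x) + exp (p \<bullet> x) * (p \<bullet> (y - x))) \<le> exp (p \<bullet> y)" .
  qed (rule i0[OF y])
  finally have "exp m * mass K x \<le> mass K y"
    by (simp add: m0)
  then have "ln (exp m * mass K x) \<le> ln (mass K y)"
    using mass_pos[OF x] mass_pos[OF y] by simp
  then show ?thesis
    using mass_pos[OF x] by (simp add: ln_mult log_laplace_def m_def)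
qed

text \<open>
  The quadratic form is the variance of \<open>p \<bullet> v\<close> under the tilted measure.
\<close>

lemma tilted_cov_nonneg:
  assumes x: "x \<in> decay_set K"
  shows "tilted_cov K x v \<bullet> v \<ge> 0"
proof -
  define m where "m = tilted_mean K x \<bullet> v"
  note c = subexponential_const[of "1::real"]
  have i0: "set_integrable lborel K (\<lambda>p. exp (p \<bullet> x))"
    using laplace_integrable[OF borel x c] by simp
  have i1: "set_integrable lborel K (\<lambda>p. exp (p \<bullet> x) * (p \<bullet> v))"
    using laplace_integrable[OF borel x subexponential_inner_scaleR[OF c, of v]] by simp
  have i2: "set_integrable lborel K (\<lambda>p. exp (p \<bullet> x) * (p \<bullet> v)\<^sup>2)"
    using laplace_integrable[OF borel x subexponential_inner_scaleR[OF subexponential_inner_scaleR[OF c, of v], of v]]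
    by (simp add: power2_eq_square mult_ac)
  have m0: "(LINT p:K|lborel. exp (p \<bullet> x)) = mass K x"
    by (simp add: mass_def laplace_def)
  have m1: "(LINT p:K|lborel. exp (p \<bullet> x) * (p \<bullet> v)) = mass K x * m"
    using mass_pos[OF x] laplace_inner[OF borel x subexponential_id, of v]
    by (simp add: m_def tilted_mean_def)
  have m2: "(LINT p:K|lborel. exp (p \<bullet> x) * (p \<bullet> v)\<^sup>2) = mass K x * (tilted_cov K x v \<bullet> v + m\<^sup>2)"
    using mass_pos[OF x]
      laplace_inner[OF borel x subexponential_inner_scaleR[OF subexponential_id, of v], of v]
    by (simp add: m_def tilted_cov_def inner_diff_left power2_eq_square)
  have "0 \<le> (LINT p:K|lborel. exp (p \<bullet> x) * (p \<bullet> v - m)\<^sup>2)"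
    unfolding set_lebesgue_integral_def by (rule Bochner_Integration.integral_nonneg) simp
  also have "\<dots> = (LINT p:K|lborel. exp (p \<bullet> x) * (p \<bullet> v)\<^sup>2 - 2 * m * (exp (p \<bullet> x) * (p \<bullet> v)) + m\<^sup>2 * exp (p \<bullet> x))"
    by (simp add: power2_eq_square algebra_simps)
  also have "\<dots> = mass K x * (tilted_cov K x v \<bullet> v + m\<^sup>2) - 2 * m * (mass K x * m) + m\<^sup>2 * mass K x"
    using i0 i1 i2 by (simp add: set_integral_add set_integral_diff m0 m1 m2)
  also have "\<dots> = mass K x * (tilted_cov K x v \<bullet> v)"
    by (simp add: power2_eq_square algebra_simps)
  finally show ?thesis
    using mass_pos[OF x] by (simp add: zero_le_mult_iff)
qed

end

text \<open>
  Equivariance of the Laplace transform. The adjointness hypothesis replaces a transpose: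
  \<open>x\<close> is the image of \<open>y\<close> under the adjoint of \<open>L\<close>.
\<close>

lemma mass_affine_invariant:
  fixes L :: "'a::euclidean_space \<Rightarrow> 'a"
  assumes L: "linear L" "volume_preserving L" "inj L"
    and K: "K \<in> sets borel" "(\<lambda>p. L p + t) ` K = K"
    and adj: "\<And>p. L p \<bullet> y = p \<bullet> x"
  shows "mass K y = exp (t \<bullet> y) * mass K x"
proof -
  define T where "T = (\<lambda>p. L p + t)"
  have "volume_preserving ((\<lambda>p. p + t) \<circ> L)"
  proof (rule volume_preserving_comp[OF _ L(2)])
    show "volume_preserving (\<lambda>p::'a. p + t)"
      using lborel_distr_plus[of t] by (simp add: volume_preserving_def add.commute[of _ t])
  qed
  then have T: "T \<in> borel_measurable borel" "distr lborel borel T = lborel"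
    by (simp_all add: volume_preserving_def T_def comp_def)
  have "inj T" using L(3) by (simp add: T_def inj_def)
  then have ind: "indicat_real K (T p) = indicat_real K p" for p
    using K(2) inj_image_mem_iff[of T p K] by (simp add: T_def indicator_def)
  have m: "mass K z = (\<integral>p. indicator K p * exp (p \<bullet> z) \<partial>lborel)" for z
    by (simp add: mass_def laplace_def set_lebesgue_integral_def)
  have "mass K y = (\<integral>p. indicator K p * exp (p \<bullet> y) \<partial>distr lborel borel T)"
    by (simp add: m T(2))
  also have "\<dots> = (\<integral>p. indicator K (T p) * exp (T p \<bullet> y) \<partial>lborel)"
    using T(1) K(1) by (intro integral_distr) auto
  also have "\<dots> = (\<integral>p. exp (t \<bullet> y) * (indicator K p * exp (p \<bullet> x)) \<partial>lborel)"
    unfolding ind by (simp add: T_def inner_add_left adj exp_add mult_ac)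
  also have "\<dots> = exp (t \<bullet> y) * mass K x"
    by (simp add: m)
  finally show ?thesis .
qed

section \<open>Minkowski geometry\<close>

text \<open>
  Time reversal turns the Minkowski form into the Euclidean inner product, which gives access to the
  Euclidean theory of the Laplace transform.
\<close>

definition flip :: "'d::finite mvec \<Rightarrow> 'd mvec" where
  "flip X = (\<chi> i. if i = None then - X $ i else X $ i)"

lemma sum_option: "(\<Sum>i\<in>UNIV. g i) = (\<Sum>i\<in>UNIV. g (Some i)) + g None"
  for g :: "'d::finite option \<Rightarrow> real"
  by (simp add: UNIV_option_conv sum.reindex)

lemma mink_flip: "mink X Y = X \<bullet> flip Y"
  by (simp add: mink_def inner_vec_def sum_option flip_def)

lemma flip_flip [simp]: "flip (flip X) = X"
  by (simp add: flip_def vec_eq_iff)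

lemma linear_flip: "linear flip"
  by (rule linearI) (simp_all add: flip_def vec_eq_iff)

lemma bounded_bilinear_mink: "bounded_bilinear (mink :: 'd::finite mvec \<Rightarrow> _)"
  using bilinear_mink bilinear_conv_bounded_bilinear by blast

lemma norm_flip [simp]: "norm (flip X) = norm X"
  by (simp add: norm_eq_sqrt_inner inner_vec_def sum_option flip_def)

lemma mink_le_norm: "\<bar>mink X Y\<bar> \<le> norm X * norm Y"
  using Cauchy_Schwarz_ineq2[of X "flip Y"] by (simp add: mink_flip)

definition space_part :: "'d::finite mvec \<Rightarrow> real ^ 'd" where
  "space_part X = (\<chi> i. X $ Some i)"

lemma mink_space_part: "mink X Y = space_part X \<bullet> space_part Y - X $ None * Y $ None"
  by (simp add: mink_def space_part_def inner_vec_def)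

lemma hyp_time_sq: "\<eta> \<in> hyp \<Longrightarrow> (\<eta> $ None)\<^sup>2 = 1 + (norm (space_part \<eta>))\<^sup>2"
  unfolding power2_norm_eq_inner by (simp add: hyp_def mink_space_part power2_eq_square)

text \<open>
  The reversed Cauchy-Schwarz inequality, normalised to the hyperboloid.
\<close>

lemma mink_hyp_le:
  assumes "\<eta> \<in> hyp" "\<zeta> \<in> hyp"
  shows "mink \<eta> \<zeta> \<le> -1"
proof -
  define a b where "a = norm (space_part \<eta>)" and "b = norm (space_part \<zeta>)"
  have "(1 + a * b)\<^sup>2 \<le> (1 + a\<^sup>2) * (1 + b\<^sup>2)"
    using sum_squares_bound[of a b] by (simp add: power2_eq_square algebra_simps)
  also have "\<dots> = (\<eta> $ None * \<zeta> $ None)\<^sup>2"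
    using assms by (simp add: hyp_time_sq a_def b_def power_mult_distrib)
  finally have "1 + a * b \<le> \<eta> $ None * \<zeta> $ None"
    by (rule power2_le_imp_le) (use assms in \<open>simp add: hyp_def\<close>)
  then show ?thesis
    using norm_cauchy_schwarz[of "space_part \<eta>" "space_part \<zeta>"]
    by (simp add: mink_space_part a_def b_def)
qed

lemma hyp_nonempty: "axis None 1 \<in> hyp"
  by (simp add: hyp_def mink_def axis_def)

lemma scale_hyp_in_future_cone: "\<eta> \<in> hyp \<Longrightarrow> t > 0 \<Longrightarrow> t *\<^sub>R \<eta> \<in> future_cone"
  by (simp add: hyp_def future_cone_def mink_simps)

lemma future_cone_scaled_hyp:
  assumes "X \<in> future_cone"
  obtains t \<eta> where "t > 0" "\<eta> \<in> hyp" "X = t *\<^sub>R \<eta>"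
proof -
  define t where "t = sqrt (- mink X X)"
  have neg: "mink X X < 0" and X: "X $ None > 0"
    using assms by (auto simp: future_cone_def)
  have t: "t > 0" "t * t = - mink X X"
    using neg by (auto simp: t_def)
  have "mink (X /\<^sub>R t) (X /\<^sub>R t) = mink X X / (t * t)"
    by (simp add: mink_simps field_simps)
  also have "\<dots> = -1"
    using t neg by simp
  finally have "X /\<^sub>R t \<in> hyp"
    using t(1) X by (simp add: hyp_def)
  with t(1) show ?thesis
    using that[of t "X /\<^sub>R t"] by simp
qed

lemma mink_future_cone_neg:
  assumes "Y \<in> future_cone" "\<eta> \<in> hyp"
  shows "mink Y \<eta> < 0"
proof -
  obtain t \<zeta> where "t > 0" "\<zeta> \<in> hyp" "Y = t *\<^sub>R \<zeta>"
    by (rule future_cone_scaled_hyp[OF assms(1)])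
  then show ?thesis
    using mink_hyp_le[of \<zeta> \<eta>] assms(2) by (simp add: mink_simps mult_pos_neg)
qed

lemma mink_tangent_pos:
  assumes \<eta>: "\<eta> \<in> hyp" and v: "v \<in> hyp_tangent \<eta>" "v \<noteq> 0"
  shows "mink v v > 0"
proof -
  define a n where "a = norm (space_part \<eta>)" and "n = norm (space_part v)"
  have eq: "v $ None * \<eta> $ None = space_part v \<bullet> space_part \<eta>"
    using v(1) by (simp add: hyp_tangent_def mink_space_part)
  have "(v $ None)\<^sup>2 * (1 + a\<^sup>2) = (space_part v \<bullet> space_part \<eta>)\<^sup>2"
    unfolding eq[symmetric] using hyp_time_sq[OF \<eta>] by (simp add: a_def power_mult_distrib)
  also have "\<dots> \<le> (n * a)\<^sup>2"
    using Cauchy_Schwarz_ineq[of "space_part v" "space_part \<eta>"]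
    by (simp add: n_def a_def power_mult_distrib power2_norm_eq_inner)
  finally have le: "(v $ None)\<^sup>2 * (1 + a\<^sup>2) \<le> n\<^sup>2 * a\<^sup>2"
    by (simp add: power_mult_distrib)
  have "n \<noteq> 0"
  proof
    assume n: "n = 0"
    then have "(v $ None)\<^sup>2 * (1 + a\<^sup>2) \<le> 0" using le by simp
    moreover have "1 + a\<^sup>2 > 0" by (smt (verit) zero_le_power2)
    ultimately have "v $ None = 0"
      by (smt (verit) mult_pos_pos zero_less_power2)
    moreover have "v $ Some i = 0" for i
      using n by (simp add: n_def space_part_def vec_eq_iff)
    ultimately have "v $ i = 0" for i by (cases i) auto
    then show False using v(2) by (simp add: vec_eq_iff)
  qed
  then have "n\<^sup>2 > 0" by simp
  moreover have "n\<^sup>2 * (1 + a\<^sup>2) = n\<^sup>2 + n\<^sup>2 * a\<^sup>2" by (simp add: algebra_simps)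
  ultimately have "(v $ None)\<^sup>2 * (1 + a\<^sup>2) < n\<^sup>2 * (1 + a\<^sup>2)"
    using le by linarith
  then have "(v $ None)\<^sup>2 < n\<^sup>2"
    by (rule mult_right_less_imp_less) simp
  then show ?thesis
    unfolding n_def power2_norm_eq_inner by (simp add: mink_space_part power2_eq_square)
qed

lemma continuous_on_mink [continuous_intros]:
  "continuous_on S a \<Longrightarrow> continuous_on S b \<Longrightarrow> continuous_on S (\<lambda>x. mink (a x) (b x))"
  by (rule bounded_bilinear.continuous_on[OF bounded_bilinear_mink])

lemma open_future_cone: "open (future_cone :: 'd::finite mvec set)"
proof -
  have "open {X :: 'd mvec. mink X X < 0}" "open {X :: 'd mvec. X $ None > 0}"
    by (intro open_Collect_less continuous_intros)+
  then show ?thesis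
    unfolding future_cone_def by (simp add: Collect_conj_eq open_Int)
qed

section \<open>Differentiation on the hyperboloid\<close>

lemma C1_on_hypI:
  fixes F :: "'d::finite mvec \<Rightarrow> 'b::real_normed_vector"
  assumes F: "\<And>\<eta>. \<eta> \<in> hyp \<Longrightarrow> (F has_derivative D \<eta>) (at \<eta> within hyp)"
    and D: "\<And>v. continuous_on hyp (\<lambda>\<eta>. D \<eta> v)"
  shows "C1_on_hyp F"
  unfolding C1_on_hyp_def
proof (intro exI[of _ "\<lambda>\<eta>. Blinfun (D \<eta>)"] conjI ballI)
  have app: "blinfun_apply (Blinfun (D \<eta>)) = D \<eta>" if "\<eta> \<in> hyp" for \<eta>
    using has_derivative_bounded_linear[OF F[OF that]] by (rule bounded_linear_Blinfun_apply)
  show "continuous_on hyp (\<lambda>\<eta>. Blinfun (D \<eta>))"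
    by (rule continuous_on_blinfun_componentwise)
      (use D in \<open>simp add: app cong: continuous_on_cong\<close>)
  show "(F has_derivative blinfun_apply (Blinfun (D \<eta>))) (at \<eta> within hyp)" if "\<eta> \<in> hyp" for \<eta>
    using F[OF that] app[OF that] by simp
qed

lemma hyp_grad_eqI:
  assumes \<eta>: "\<eta> \<in> hyp" and u: "u \<in> hyp_tangent \<eta>"
    and f: "(f has_derivative (\<lambda>v. mink u v)) (at \<eta> within hyp)"
  shows "hyp_grad f \<eta> = u"
  unfolding hyp_grad_def
proof (rule the_equality)
  show "u \<in> hyp_tangent \<eta> \<and> (f has_derivative (\<lambda>v. mink u v)) (at \<eta> within hyp)"
    using u f by simp
  fix w assume w: "w \<in> hyp_tangent \<eta> \<and> (f has_derivative (\<lambda>v. mink w v)) (at \<eta> within hyp)"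
  then have t: "w - u \<in> hyp_tangent \<eta>"
    using u by (simp add: hyp_tangent_def mink_simps)
  have "mink w (w - u) = mink u (w - u)"
    using hyp_derivative_unique[OF \<eta> t _ f] w by blast
  then have "mink (w - u) (w - u) = 0"
    by (simp add: mink_simps)
  then show "w = u"
    using mink_tangent_pos[OF \<eta> t] by auto
qed

text \<open>
  For a function on an open neighbourhood with Minkowski gradient \<open>P\<close>, the hyperbolic gradient is the
  tangential projection of \<open>P\<close>. Since geodesics have acceleration \<open>\<langle>v,v\<rangle>\<eta>\<close>, the hyperbolic Hessian is the
  ambient one plus \<open>\<langle>P,\<eta>\<rangle>\<close> times the metric.
\<close>

lemma C2_plusI:
  fixes f :: "'d::finite mvec \<Rightarrow> real" and P :: "'d mvec \<Rightarrow> 'd mvec"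
  assumes f: "\<And>\<eta>. \<eta> \<in> hyp \<Longrightarrow> (f has_derivative mink (P \<eta>)) (at \<eta>)"
    and P: "\<And>\<eta>. \<eta> \<in> hyp \<Longrightarrow> (P has_derivative D \<eta>) (at \<eta>)"
    and D: "\<And>v. continuous_on hyp (\<lambda>\<eta>. D \<eta> v)"
    and pos: "\<And>\<eta> v. \<eta> \<in> hyp \<Longrightarrow> v \<in> hyp_tangent \<eta> \<Longrightarrow> v \<noteq> 0 \<Longrightarrow>
                mink (D \<eta> v) v + (mink (P \<eta>) \<eta> - f \<eta>) * mink v v > 0"
  shows "C2_plus f"
proof -
  define Q where "Q \<eta> = P \<eta> + mink (P \<eta>) \<eta> *\<^sub>R \<eta>" for \<eta>
  define Q' where "Q' \<eta> v = D \<eta> v + (mink (P \<eta>) \<eta> *\<^sub>R v + (mink (P \<eta>) v + mink (D \<eta> v) \<eta>) *\<^sub>R \<eta>)" for \<eta> v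
  have P_cont: "continuous_on hyp P"
    using P has_derivative_continuous continuous_at_imp_continuous_on by blast
  have Q': "(Q has_derivative Q' \<eta>) (at \<eta> within hyp)" if "\<eta> \<in> hyp" for \<eta>
  proof -
    have "(Q has_derivative Q' \<eta>) (at \<eta>)"
      unfolding Q_def[abs_def] Q'_def[abs_def]
      by (intro has_derivative_add has_derivative_scaleR P[OF that] has_derivative_ident
          bounded_bilinear.FDERIV[OF bounded_bilinear_mink])
    then show ?thesis by (rule has_derivative_at_withinI)
  qed
  have grad: "hyp_grad f \<eta> = Q \<eta>" if \<eta>: "\<eta> \<in> hyp" for \<eta>
  proof (rule hyp_grad_eqI[OF \<eta>])
    have e: "mink \<eta> \<eta> = -1" using \<eta> by (simp add: hyp_def)
    show "Q \<eta> \<in> hyp_tangent \<eta>"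
      by (simp add: hyp_tangent_def Q_def mink_simps e)
    show "(f has_derivative mink (Q \<eta>)) (at \<eta> within hyp)"
    proof -
      define c where "c = mink (P \<eta>) \<eta>"
      \<comment> \<open>The added term vanishes on the hyperboloid, and its gradient supplies the normal part of \<open>Q\<close>.\<close>
      have "((\<lambda>X. f X + c / 2 * (mink X X + 1)) has_derivative
          (\<lambda>v. mink (P \<eta>) v + c / 2 * (mink \<eta> v + mink v \<eta> + 0))) (at \<eta>)"
        by (intro has_derivative_add f[OF \<eta>] has_derivative_mult_right has_derivative_const
            bounded_bilinear.FDERIV[OF bounded_bilinear_mink] has_derivative_ident)
      also have "(\<lambda>v. mink (P \<eta>) v + c / 2 * (mink \<eta> v + mink v \<eta> + 0)) = mink (Q \<eta>)"
        by (simp add: fun_eq_iff Q_def c_def mink_simps mink_commute[of _ \<eta>])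
      finally have "((\<lambda>X. f X + c / 2 * (mink X X + 1)) has_derivative mink (Q \<eta>)) (at \<eta> within hyp)"
        by (rule has_derivative_at_withinI)
      then show ?thesis
        by (rule has_derivative_transform[OF \<eta>, rotated]) (simp add: hyp_def)
    qed
  qed
  have grad': "(hyp_grad f has_derivative Q' \<eta>) (at \<eta> within hyp)" if "\<eta> \<in> hyp" for \<eta>
    using grad by (intro has_derivative_transform[OF that _ Q'[OF that]]) simp
  have "C2_on_hyp f"
    unfolding C2_on_hyp_def
  proof
    show "C1_on_hyp f"
      by (rule C1_on_hypI[OF has_derivative_at_withinI[OF f]]) (auto intro!: continuous_intros P_cont)
    show "C1_on_hyp (hyp_grad f)"
      unfolding Q'_def[abs_def]
      by (rule C1_on_hypI[OF grad']) (auto simp: Q'_def intro!: continuous_intros P_cont D)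
  qed
  moreover have "hyp_hess f \<eta> v v - f \<eta> * mink v v > 0"
    if \<eta>: "\<eta> \<in> hyp" and v: "v \<in> hyp_tangent \<eta>" "v \<noteq> 0" for \<eta> v
  proof -
    have "(hyp_grad f has_derivative frechet_derivative (hyp_grad f) (at \<eta> within hyp)) (at \<eta> within hyp)"
      using grad'[OF \<eta>] by (auto simp: differentiable_def frechet_derivative_works[symmetric])
    then have "frechet_derivative (hyp_grad f) (at \<eta> within hyp) v = Q' \<eta> v"
      by (rule hyp_derivative_unique[OF \<eta> v(1) _ grad'[OF \<eta>]])
    then have "hyp_hess f \<eta> v v = mink (D \<eta> v) v + mink (P \<eta>) \<eta> * mink v v"
      using v(1) by (simp add: hyp_hess_def Q'_def mink_simps hyp_tangent_def mink_commute[of \<eta> v])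
    then show ?thesis
      using pos[OF \<eta> v] by (simp add: algebra_simps)
  qed
  ultimately show ?thesis
    by (simp add: C2_plus_def)
qed

section \<open>Lorentz maps and uniform lattices\<close>

lemma SO_plusD:
  assumes "A \<in> carrier SO_plus"
  shows "mink (A *v X) (A *v Y) = mink X Y" "((*v) A) ` future_cone = future_cone"
  using assms by (auto simp: SO_plus_def)

lemma SO_plus_hyp:
  assumes "A \<in> carrier SO_plus" "\<eta> \<in> hyp"
  shows "A *v \<eta> \<in> hyp"
proof -
  have "\<eta> \<in> future_cone"
    using scale_hyp_in_future_cone[OF assms(2), of 1] by simp
  then have "A *v \<eta> \<in> future_cone"
    using SO_plusD(2)[OF assms(1)] by blast
  then show ?thesis
    using assms(2) SO_plusD(1)[OF assms(1)] by (simp add: hyp_def future_cone_def)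
qed

text \<open>
  Let \<open>e\<close> be the unit timelike vector. A Lorentz map fixing \<open>e\<close> preserves the Euclidean norm. Any other
  map \<open>A\<close> is reduced to this case by composing it with the Lorentz reflection that exchanges \<open>A e\<close> and
  \<open>e\<close>, which is an involution.
\<close>

lemma SO_plus_volume_preserving:
  fixes A :: "'d::finite mmat"
  assumes A: "A \<in> carrier SO_plus"
  shows "volume_preserving ((*v) A)"
proof -
  define e :: "'d mvec" where "e = axis None 1"
  have e: "e \<in> hyp" "mink e e = -1" using hyp_nonempty by (auto simp: e_def hyp_def)
  have mink_e: "mink X e = - X $ None" for X :: "'d mvec"
    by (simp add: mink_def e_def axis_def)
  have fix_e: "volume_preserving f"
    if f: "linear f" "\<And>X Y. mink (f X) (f Y) = mink X Y" "f e = e" for f :: "'d mvec \<Rightarrow> 'd mvec"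
  proof (rule volume_preserving_isometry[OF f(1)])
    fix X
    have eq: "X \<bullet> X = mink X X + 2 * (mink X e)\<^sup>2" for X :: "'d mvec"
      by (simp add: mink_e) (simp add: mink_def inner_vec_def sum_option power2_eq_square)
    have "mink (f X) e = mink X e"
      using f(2)[of X e] f(3) by simp
    then have "f X \<bullet> f X = X \<bullet> X"
      using f(2)[of X X] by (simp add: eq)
    then show "norm (f X) = norm X"
      by (simp add: norm_eq_sqrt_inner)
  qed
  define w where "w = A *v e - e"
  show ?thesis
  proof (cases "w = 0")
    case True
    then show ?thesis
      using SO_plusD(1)[OF A] by (intro fix_e) (auto simp: w_def)
  next
    case False
    have Ae: "A *v e \<in> hyp" "mink (A *v e) (A *v e) = -1"
      using SO_plus_hyp[OF A e(1)] by (auto simp: hyp_def)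
    have w: "mink w w = - 2 * (1 + mink (A *v e) e)"
      by (simp add: w_def mink_simps Ae e mink_commute[of e "A *v e"])
    have w0: "mink w w \<noteq> 0"
    proof
      assume "mink w w = 0"
      then have 1: "(A *v e) $ None = 1" using w by (simp add: mink_e)
      then have "space_part (A *v e) = 0"
        using hyp_time_sq[OF Ae(1)] by simp
      then have "(A *v e) $ i = e $ i" for i
        using 1 by (cases i) (auto simp: space_part_def vec_eq_iff e_def axis_def)
      then have "A *v e = e" by (simp add: vec_eq_iff)
      with False show False by (simp add: w_def)
    qed
    define k where "k = 2 / mink w w"
    have k: "k * mink w w = 2" using w0 by (simp add: k_def)
    define R where "R X = X - (k * mink X w) *\<^sub>R w" for X
    have R: "linear R"
      by (rule linearI) (simp_all add: R_def mink_simps algebra_simps)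
    have Rw: "mink (R X) w = - mink X w" for X
    proof -
      have "mink (R X) w = mink X w - mink X w * (k * mink w w)"
        by (simp add: R_def mink_simps)
      then show ?thesis by (simp add: k)
    qed
    have RR: "R (R X) = X" for X
    proof -
      have "R (R X) = R X + (k * mink X w) *\<^sub>R w"
        by (subst R_def) (simp add: Rw)
      then show ?thesis by (simp add: R_def)
    qed
    have R_mink: "mink (R X) (R Y) = mink X Y" for X Y
    proof -
      have "mink (R X) (R Y) = mink (R X) Y + k * mink Y w * mink X w"
        by (subst (2) R_def) (simp add: mink_simps Rw)
      then show ?thesis by (simp add: R_def mink_simps mink_commute[of w Y])
    qed
    have "R (A *v e) = e"
    proof -
      have "2 * mink (A *v e) w = mink w w"
        unfolding w by (simp add: w_def mink_simps Ae)
      then have "k * (2 * mink (A *v e) w) = 2" by (simp only: k)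
      then have "k * mink (A *v e) w = 1" by simp
      then have "R (A *v e) = A *v e - w" by (simp only: R_def scaleR_one)
      then show ?thesis by (simp add: w_def)
    qed
    then have "volume_preserving (R \<circ> (*v) A)"
      by (intro fix_e linear_compose[OF matrix_vector_mul_linear R])
        (simp_all only: comp_def R_mink SO_plusD(1)[OF A])
    moreover have "volume_preserving R"
      using R RR by (rule volume_preserving_involution)
    ultimately have "volume_preserving (R \<circ> (R \<circ> (*v) A))"
      using volume_preserving_comp by blast
    then show ?thesis by (simp add: comp_def RR)
  qed
qed

lemma SO_plus_inj:
  assumes "A \<in> carrier SO_plus"
  shows "inj ((*v) A)"
proof (rule injI)
  fix X Y assume "A *v X = A *v Y"
  then have "mink (X - Y) Z = 0" for Z
    using SO_plusD(1)[OF assms, of "X - Y" Z] by (simp add: matrix_vector_mult_diff_distrib mink_simps)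
  from this[of "flip (X - Y)"] show "X = Y"
    by (simp add: mink_flip)
qed

lemma SO_plus_image_hyp:
  fixes A :: "'d::finite mmat"
  assumes "A \<in> carrier SO_plus"
  shows "((*v) A) ` hyp = hyp"
proof
  show "((*v) A) ` hyp \<subseteq> hyp"
    using SO_plus_hyp[OF assms] by blast
  show "hyp \<subseteq> ((*v) A) ` hyp"
  proof
    fix \<eta> :: "'d mvec" assume \<eta>: "\<eta> \<in> hyp"
    then have "\<eta> \<in> future_cone"
      using scale_hyp_in_future_cone[of \<eta> 1] by simp
    then obtain X where X: "X \<in> future_cone" "\<eta> = A *v X"
      using SO_plusD(2)[OF assms] by blast
    then have "X \<in> hyp"
      using \<eta> SO_plusD(1)[OF assms, of X X] by (simp add: hyp_def future_cone_def)
    with X(2) show "\<eta> \<in> ((*v) A) ` hyp" by blast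
  qed
qed

lemma closed_hyp: "closed (hyp :: 'd::finite mvec set)"
proof -
  have "X $ None \<noteq> 0" if "mink X X = -1" for X :: "'d mvec"
    using that inner_ge_zero[of "space_part X"] by (auto simp: mink_space_part simp del: inner_ge_zero)
  then have eq: "hyp = {X :: 'd mvec. mink X X = -1} \<inter> {X. X $ None \<ge> 0}"
    by (force simp: hyp_def)
  show ?thesis
    unfolding eq by (intro closed_Int closed_Collect_eq closed_Collect_le continuous_intros)
qed

text \<open>
  The orbits meeting the ball of radius \<open>n\<close> form an increasing open cover of the compact quotient.
\<close>

lemma uniform_lattice_bounded_representatives:
  assumes \<Gamma>: "uniform_lattice \<Gamma>"
  obtains R where "\<And>\<eta>. \<eta> \<in> hyp \<Longrightarrow> \<exists>\<gamma>\<in>\<Gamma>. norm (\<gamma> *v \<eta>) < R"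
proof -
  let ?orb = "orbit (SO_plus\<lparr>carrier := \<Gamma>\<rparr>) (*v)"
  have orb: "?orb \<eta> = {\<gamma> *v \<eta> | \<gamma>. \<gamma> \<in> \<Gamma>}" for \<eta>
    by (simp add: orbit_def)
  have top: "topspace (hyp_quotient \<Gamma>) = hyp_orbits \<Gamma>" and "compact_space (hyp_quotient \<Gamma>)"
    using quotient_imp_surjective_map[OF quotient_map_hyp_quotient[of \<Gamma>]] \<Gamma>
    by (auto simp: hyp_orbits_def orbits_def uniform_lattice_def)
  define U where "U n = {c \<in> hyp_orbits \<Gamma>. \<exists>X\<in>c. norm X < real n}" for n :: nat
  have pre: "{\<eta> \<in> hyp. ?orb \<eta> \<in> U n} = hyp \<inter> (\<Union>\<gamma>\<in>\<Gamma>. {\<eta>. norm (\<gamma> *v \<eta>) < real n})" for n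
    by (auto simp: U_def orb hyp_orbits_def orbits_def)
  have U_open: "openin (hyp_quotient \<Gamma>) (U n)" for n
    unfolding openin_hyp_quotient
  proof
    have "open (\<Union>\<gamma>\<in>\<Gamma>. {\<eta>. norm (\<gamma> *v \<eta>) < real n})"
      by (intro open_UN ballI open_Collect_less continuous_intros
          linear_continuous_on[OF matrix_vector_mul_bounded_linear])
    then show "openin (top_of_set hyp) {\<eta> \<in> hyp. ?orb \<eta> \<in> U n}"
      unfolding pre by (rule openin_open_Int)
  qed (auto simp: U_def)
  have "topspace (hyp_quotient \<Gamma>) \<subseteq> \<Union> (range U)"
  proof -
    have "c \<in> \<Union>(range U)" if c: "c \<in> hyp_orbits \<Gamma>" for c
    proof -
      have "\<Gamma> \<noteq> {}"
        using \<Gamma> subgroup.one_closed by (fastforce simp: uniform_lattice_def)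
      then obtain X where "X \<in> c"
        using c by (auto simp: hyp_orbits_def orbits_def orb)
      moreover obtain n :: nat where "norm X < real n"
        using reals_Archimedean2 by blast
      ultimately show ?thesis using c by (auto simp: U_def)
    qed
    then show ?thesis by (auto simp: top)
  qed
  moreover have "\<forall>V\<in>range U. openin (hyp_quotient \<Gamma>) V"
    using U_open by blast
  ultimately have "\<exists>F. finite F \<and> F \<subseteq> range U \<and> topspace (hyp_quotient \<Gamma>) \<subseteq> \<Union> F"
    using \<open>compact_space _\<close> unfolding compact_space_alt by blast
  then obtain I where I: "finite I" "hyp_orbits \<Gamma> \<subseteq> (\<Union>n\<in>I. U n)"
    unfolding top by (metis finite_subset_image)
  define R where "R = real (Max (insert 0 I))"
  have "\<exists>\<gamma>\<in>\<Gamma>. norm (\<gamma> *v \<eta>) < R" if \<eta>: "\<eta> \<in> hyp" for \<eta>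
  proof -
    have "?orb \<eta> \<in> hyp_orbits \<Gamma>" using \<eta> by (auto simp: hyp_orbits_def orbits_def)
    then obtain n \<gamma> where n: "n \<in> I" "\<gamma> \<in> \<Gamma>" "norm (\<gamma> *v \<eta>) < real n"
      using I(2) by (auto simp: U_def orb)
    have "real n \<le> R" using n(1) I(1) by (simp add: R_def)
    with n show ?thesis by force
  qed
  then show ?thesis using that by blast
qed

section \<open>The soft maximum over an equivariant convex set\<close>

locale tau_convex_body =
  fixes \<Gamma> :: "'d::finite mmat set" and \<tau> :: "'d mmat \<Rightarrow> 'd mvec"
    and K :: "'d mvec set" and h :: "'d mvec \<Rightarrow> real"
  assumes lattice: "uniform_lattice \<Gamma>"
    and tau_convex: "tau_convex \<Gamma> \<tau> K"
    and support: "hyp_support_function K h"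
begin

lemma SO_plus: "\<gamma> \<in> \<Gamma> \<Longrightarrow> \<gamma> \<in> carrier SO_plus"
  using lattice subgroup.mem_carrier[of \<Gamma> SO_plus] unfolding uniform_lattice_def by blast

lemma K_affine: "\<gamma> \<in> \<Gamma> \<Longrightarrow> (\<lambda>X. \<gamma> *v X + \<tau> \<gamma>) ` K = K"
  using tau_convex by (auto simp: tau_convex_def affine_maps_def)

lemma K_future: "X \<in> K \<Longrightarrow> Y \<in> future_cone \<Longrightarrow> X + Y \<in> K"
  using tau_convex unfolding tau_convex_def by blast

lemma K_nonempty: "K \<noteq> {}"
  using tau_convex by (auto simp: tau_convex_def)

lemma support_ge:
  assumes "p \<in> K" "\<eta> \<in> hyp"
  shows "mink p \<eta> \<le> h \<eta>"
proof -
  have "ereal (mink p \<eta>) \<le> (SUP p\<in>K. ereal (mink p \<eta>))"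
    using assms(1) by (rule SUP_upper)
  also have "\<dots> = ereal (h \<eta>)"
    using support assms(2) by (simp add: hyp_support_function_def)
  finally show ?thesis by simp
qed

lemma support_approx:
  assumes "\<eta> \<in> hyp" "e > 0"
  obtains p where "p \<in> K" "mink p \<eta> > h \<eta> - e"
proof -
  have "ereal (h \<eta> - e) < (SUP p\<in>K. ereal (mink p \<eta>))"
    using support assms unfolding hyp_support_function_def
    by (metis diff_less_eq ereal_less_eq(3) less_add_same_cancel1 less_ereal.simps(1))
  then show ?thesis
    using that by (auto simp: less_SUP_iff)
qed

text \<open>
  Finiteness of the support function on the hyperboloid extends to the open cone by homogeneity.
\<close>

lemma flip_future_cone_decay:
  assumes "X \<in> future_cone"
  shows "flip X \<in> decay_set K"
proof (rule decay_setI)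
  show "open (flip -` future_cone :: 'd mvec set)"
    by (intro open_vimage open_future_cone linear_continuous_on)
      (use linear_flip in \<open>simp add: linear_conv_bounded_linear\<close>)
  show "flip X \<in> flip -` future_cone"
    using assms by simp
  fix y :: "'d mvec" assume "y \<in> flip -` future_cone"
  then obtain t \<eta> where t: "t > 0" "\<eta> \<in> hyp" "flip y = t *\<^sub>R \<eta>"
    using future_cone_scaled_hyp by (metis vimageE)
  have "p \<bullet> y \<le> t * h \<eta>" if "p \<in> K" for p
  proof -
    have "p \<bullet> y = mink p (flip y)" by (simp add: mink_flip)
    also have "\<dots> = t * mink p \<eta>" by (simp add: t mink_simps)
    finally show ?thesis using support_ge[OF that t(2)] t(1) by simp
  qed
  then show "bdd_above ((\<lambda>p. p \<bullet> y) ` K)"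
    by (auto simp: bdd_above_def)
qed

lemma translated_future_cone_subset:
  "p \<in> K \<Longrightarrow> S \<subseteq> future_cone \<Longrightarrow> (+) p ` S \<subseteq> K"
  by (meson K_future image_subsetI subsetD)

lemma future_cone_meets_ball:
  assumes "r > 0"
  shows "future_cone \<inter> ball 0 r \<noteq> ({} :: 'd mvec set)"
proof -
  have "(r / 2) *\<^sub>R axis None 1 \<in> (future_cone :: 'd mvec set)"
    using assms by (intro scale_hyp_in_future_cone hyp_nonempty) auto
  moreover have "norm ((r / 2) *\<^sub>R axis None 1 :: 'd mvec) < r"
    using assms by simp
  ultimately show ?thesis by auto
qed

sublocale laplace_domain K
proof
  show "K \<in> sets borel"
    using tau_convex by (simp add: tau_convex_def)
  obtain p where p: "p \<in> K" using K_nonempty by blast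
  have "(+) p ` (future_cone \<inter> ball 0 1) \<subseteq> interior K"
    using open_future_cone translated_future_cone_subset[OF p]
    by (intro interior_maximal open_translation open_Int) auto
  then show "interior K \<noteq> {}"
    using future_cone_meets_ball[of 1] by fastforce
qed

text \<open>
  The functions \<open>F\<^sub>N\<close> of the introduction, with their Minkowski gradients.
\<close>

definition soft_support :: "real \<Rightarrow> 'd mvec \<Rightarrow> real" where
  "soft_support N \<eta> = log_laplace K (N *\<^sub>R flip \<eta>) / N"

definition soft_point :: "real \<Rightarrow> 'd mvec \<Rightarrow> 'd mvec" where
  "soft_point N \<eta> = tilted_mean K (N *\<^sub>R flip \<eta>)"

lemma scaled_decay:
  assumes "X \<in> future_cone" "N > 0"
  shows "N *\<^sub>R flip X \<in> decay_set K"
proof -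
  have "N *\<^sub>R X \<in> future_cone"
    using assms by (simp add: future_cone_def mink_simps mult_pos_neg)
  from flip_future_cone_decay[OF this] show ?thesis
    by (simp add: linear_scale[OF linear_flip])
qed

lemma hyp_in_future_cone: "\<eta> \<in> hyp \<Longrightarrow> \<eta> \<in> (future_cone :: 'd mvec set)"
  using scale_hyp_in_future_cone[of \<eta> 1] by simp

lemma has_derivative_scaled_flip:
  "((\<lambda>X. N *\<^sub>R flip X) has_derivative (\<lambda>v. N *\<^sub>R flip v)) (at (\<eta> :: 'd mvec))"
  using linear_flip
  by (intro has_derivative_scaleR_right bounded_linear_imp_has_derivative)
    (simp add: linear_conv_bounded_linear)

lemma soft_support_has_derivative:
  assumes "\<eta> \<in> hyp" "N > 0"
  shows "(soft_support N has_derivative mink (soft_point N \<eta>)) (at \<eta>)"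
proof -
  have "((\<lambda>X. log_laplace K (N *\<^sub>R flip X)) has_derivative
      (\<lambda>v. soft_point N \<eta> \<bullet> (N *\<^sub>R flip v))) (at \<eta>)"
    unfolding soft_point_def
    using log_laplace_has_derivative[OF scaled_decay[OF hyp_in_future_cone[OF assms(1)] assms(2)]]
    by (rule has_derivative_compose[OF has_derivative_scaled_flip])
  then have "((\<lambda>X. log_laplace K (N *\<^sub>R flip X) * inverse N) has_derivative
      (\<lambda>v. soft_point N \<eta> \<bullet> (N *\<^sub>R flip v) * inverse N)) (at \<eta>)"
    by (rule has_derivative_mult_left)
  then show ?thesis
    using assms(2) by (simp add: soft_support_def[abs_def] mink_flip[abs_def] field_simps)
qed

lemma soft_point_has_derivative:
  assumes "\<eta> \<in> hyp" "N > 0"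
  shows "(soft_point N has_derivative (\<lambda>v. tilted_cov K (N *\<^sub>R flip \<eta>) (N *\<^sub>R flip v))) (at \<eta>)"
  unfolding soft_point_def[abs_def]
  using tilted_mean_has_derivative[OF scaled_decay[OF hyp_in_future_cone[OF assms(1)] assms(2)]]
  by (rule has_derivative_compose[OF has_derivative_scaled_flip])

lemma continuous_on_scaled_flip: "continuous_on S (\<lambda>X :: 'd mvec. N *\<^sub>R flip X)"
  by (intro continuous_at_imp_continuous_on ballI has_derivative_continuous[OF has_derivative_scaled_flip])

lemma soft_support_tangent:
  assumes "X \<in> future_cone" "Y \<in> future_cone" "N > 0"
  shows "soft_support N X + mink (soft_point N X) (Y - X) \<le> soft_support N Y"
proof -
  have "log_laplace K (N *\<^sub>R flip X) + soft_point N X \<bullet> (N *\<^sub>R flip Y - N *\<^sub>R flip X)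
      \<le> log_laplace K (N *\<^sub>R flip Y)"
    unfolding soft_point_def
    by (rule log_laplace_tangent[OF scaled_decay[OF assms(1,3)] scaled_decay[OF assms(2,3)]])
  also have "N *\<^sub>R flip Y - N *\<^sub>R flip X = N *\<^sub>R flip (Y - X)"
    by (simp add: linear_diff[OF linear_flip] scaleR_diff_right)
  finally have "(log_laplace K (N *\<^sub>R flip X) + N * mink (soft_point N X) (Y - X)) / N
      \<le> log_laplace K (N *\<^sub>R flip Y) / N"
    using assms(3) by (intro divide_right_mono) (simp_all add: mink_flip)
  then show ?thesis
    using assms(3) by (simp add: soft_support_def add_divide_distrib)
qed

text \<open>
  The tangent inequality between \<open>\<eta>\<close> and \<open>\<eta> / 2\<close>. Halving the argument amounts to halving \<open>N\<close>, so the
  failure of homogeneity of \<open>F\<^sub>N\<close> is controlled by \<open>F\<^bsub>N/2\<^esub> - F\<^sub>N\<close>.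
\<close>

lemma mink_soft_point_ge:
  assumes "\<eta> \<in> hyp" "N > 0"
  shows "2 * soft_support N \<eta> - soft_support (N / 2) \<eta> \<le> mink (soft_point N \<eta>) \<eta>"
proof -
  have "soft_support N \<eta> + mink (soft_point N \<eta>) ((1/2) *\<^sub>R \<eta> - \<eta>) \<le> soft_support N ((1/2) *\<^sub>R \<eta>)"
    using assms by (intro soft_support_tangent scale_hyp_in_future_cone hyp_in_future_cone) auto
  moreover have "soft_support N ((1/2) *\<^sub>R \<eta>) = soft_support (N / 2) \<eta> / 2"
    by (simp add: soft_support_def linear_scale[OF linear_flip])
  moreover have "mink (soft_point N \<eta>) ((1/2) *\<^sub>R \<eta> - \<eta>) = - mink (soft_point N \<eta>) \<eta> / 2"
    by (simp add: mink_simps)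
  ultimately show ?thesis by linarith
qed

lemma soft_support_equivariant:
  assumes \<gamma>: "\<gamma> \<in> \<Gamma>" and \<eta>: "\<eta> \<in> hyp" and N: "N > 0"
  shows "soft_support N (\<gamma> *v \<eta>) = soft_support N \<eta> + mink (\<tau> \<gamma>) (\<gamma> *v \<eta>)"
proof -
  note A = SO_plus[OF \<gamma>]
  have "inj ((*v) \<gamma>)"
    by (rule SO_plus_inj[OF A])
  then have "mass K (N *\<^sub>R flip (\<gamma> *v \<eta>)) = exp (\<tau> \<gamma> \<bullet> (N *\<^sub>R flip (\<gamma> *v \<eta>))) * mass K (N *\<^sub>R flip \<eta>)"
  proof (rule mass_affine_invariant[OF matrix_vector_mul_linear SO_plus_volume_preserving[OF A] _ borel K_affine[OF \<gamma>]])
    show "(\<gamma> *v p) \<bullet> (N *\<^sub>R flip (\<gamma> *v \<eta>)) = p \<bullet> (N *\<^sub>R flip \<eta>)" for p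
      using SO_plusD(1)[OF A, of p \<eta>] by (simp add: mink_flip)
  qed
  then have "log_laplace K (N *\<^sub>R flip (\<gamma> *v \<eta>)) = N * mink (\<tau> \<gamma>) (\<gamma> *v \<eta>) + log_laplace K (N *\<^sub>R flip \<eta>)"
    using mass_pos[OF scaled_decay[OF hyp_in_future_cone[OF \<eta>] N]]
    by (simp add: log_laplace_def ln_mult mink_flip)
  then show ?thesis
    using N by (simp add: soft_support_def field_simps)
qed

lemma support_equivariant:
  assumes \<gamma>: "\<gamma> \<in> \<Gamma>" and \<eta>: "\<eta> \<in> hyp"
  shows "h (\<gamma> *v \<eta>) = h \<eta> + mink (\<tau> \<gamma>) (\<gamma> *v \<eta>)"
proof -
  note A = SO_plus[OF \<gamma>]
  have \<gamma>\<eta>: "\<gamma> *v \<eta> \<in> hyp" using SO_plus_hyp[OF A \<eta>] .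
  have eq: "mink (\<gamma> *v p + \<tau> \<gamma>) (\<gamma> *v \<eta>) = mink p \<eta> + mink (\<tau> \<gamma>) (\<gamma> *v \<eta>)" for p
    by (simp add: mink_simps SO_plusD(1)[OF A])
  show ?thesis
  proof (rule antisym)
    show "h (\<gamma> *v \<eta>) \<le> h \<eta> + mink (\<tau> \<gamma>) (\<gamma> *v \<eta>)"
    proof (rule field_le_epsilon)
      fix e :: real assume "e > 0"
      then obtain q where q: "q \<in> K" "mink q (\<gamma> *v \<eta>) > h (\<gamma> *v \<eta>) - e"
        using support_approx[OF \<gamma>\<eta>] by blast
      obtain p where "p \<in> K" "q = \<gamma> *v p + \<tau> \<gamma>"
        using q(1) K_affine[OF \<gamma>] by blast
      then show "h (\<gamma> *v \<eta>) \<le> h \<eta> + mink (\<tau> \<gamma>) (\<gamma> *v \<eta>) + e"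
        using q(2) support_ge[of p \<eta>] \<eta> by (simp add: eq)
    qed
    show "h \<eta> + mink (\<tau> \<gamma>) (\<gamma> *v \<eta>) \<le> h (\<gamma> *v \<eta>)"
    proof (rule field_le_epsilon)
      fix e :: real assume "e > 0"
      then obtain p where p: "p \<in> K" "mink p \<eta> > h \<eta> - e"
        using support_approx[OF \<eta>] by blast
      then have "\<gamma> *v p + \<tau> \<gamma> \<in> K"
        using K_affine[OF \<gamma>] by blast
      from support_ge[OF this \<gamma>\<eta>] p(2)
      show "h \<eta> + mink (\<tau> \<gamma>) (\<gamma> *v \<eta>) \<le> h (\<gamma> *v \<eta>) + e"
        by (simp add: eq)
    qed
  qed
qed

lemma mass_integral:
  assumes "X \<in> future_cone"
  shows "integrable lborel (\<lambda>p. indicator K p * exp (mink p X))"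
    "mass K (flip X) = (\<integral>p. indicator K p * exp (mink p X) \<partial>lborel)"
  using laplace_integrable[OF borel flip_future_cone_decay[OF assms] subexponential_const[of "1::real"]]
  by (simp_all add: set_integrable_def mass_def laplace_def set_lebesgue_integral_def mink_flip)

text \<open>
  In the integrand all but one of the \<open>N\<close> factors \<open>exp (mink p \<eta>)\<close> are replaced by their supremum; the
  last factor keeps the integral finite.
\<close>

lemma soft_support_le:
  assumes \<eta>: "\<eta> \<in> hyp" and N: "N \<ge> 1"
  shows "soft_support N \<eta> \<le> h \<eta> + (log_laplace K (flip \<eta>) - h \<eta>) / N"
proof -
  have cone: "N *\<^sub>R \<eta> \<in> future_cone" "\<eta> \<in> future_cone"
    using scale_hyp_in_future_cone[OF \<eta>] hyp_in_future_cone[OF \<eta>] N by auto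
  have "mass K (flip (N *\<^sub>R \<eta>)) \<le> (\<integral>p. exp ((N - 1) * h \<eta>) * (indicator K p * exp (mink p \<eta>)) \<partial>lborel)"
    unfolding mass_integral(2)[OF cone(1)]
  proof (rule integral_mono)
    show "integrable lborel (\<lambda>p. exp ((N - 1) * h \<eta>) * (indicator K p * exp (mink p \<eta>)))"
      using mass_integral(1)[OF cone(2)] by (rule integrable_mult_right)
    fix p
    have "N * mink p \<eta> \<le> (N - 1) * h \<eta> + mink p \<eta>" if "p \<in> K"
      using mult_left_mono[OF support_ge[OF that \<eta>], of "N - 1"] N by (simp add: algebra_simps)
    then show "indicator K p * exp (mink p (N *\<^sub>R \<eta>)) \<le> exp ((N - 1) * h \<eta>) * (indicator K p * exp (mink p \<eta>))"
      by (cases "p \<in> K") (simp_all add: mink_simps flip: exp_add)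
  qed (rule mass_integral(1)[OF cone(1)])
  also have "\<dots> = exp ((N - 1) * h \<eta>) * mass K (flip \<eta>)"
    by (simp add: mass_integral(2)[OF cone(2)])
  finally have "ln (mass K (flip (N *\<^sub>R \<eta>))) \<le> ln (exp ((N - 1) * h \<eta>) * mass K (flip \<eta>))"
    using mass_pos[OF flip_future_cone_decay[OF cone(1)]] mass_pos[OF flip_future_cone_decay[OF cone(2)]]
    by (subst ln_le_cancel_iff) auto
  then have "log_laplace K (N *\<^sub>R flip \<eta>) \<le> (N - 1) * h \<eta> + log_laplace K (flip \<eta>)"
    using mass_pos[OF flip_future_cone_decay[OF cone(2)]]
    by (simp add: log_laplace_def ln_mult linear_scale[OF linear_flip])
  then show ?thesis
    using N by (simp add: soft_support_def field_simps)
qed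

text \<open>
  Since \<open>K\<close> absorbs the future cone, an almost maximal point \<open>p\<close> of \<open>K\<close> comes with a translate of a
  small piece of the cone, on which \<open>mink _ \<eta>\<close> is still almost maximal and whose volume depends neither on \<open>p\<close>
  nor on \<open>\<eta>\<close>.
\<close>

lemma soft_support_ge:
  assumes \<eta>: "\<eta> \<in> hyp" and N: "N > 0" and r: "r > 0"
  shows "soft_support N \<eta> \<ge> h \<eta> - r * norm \<eta> + ln (measure lebesgue (future_cone \<inter> ball (0::'d mvec) r)) / N"
proof (rule field_le_epsilon)
  fix e :: real assume e: "e > 0"
  have cone: "N *\<^sub>R \<eta> \<in> future_cone"
    using scale_hyp_in_future_cone[OF \<eta> N] .
  obtain p where p: "p \<in> K" "mink p \<eta> > h \<eta> - e"
    using support_approx[OF \<eta> e] .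
  define B where "B = (future_cone \<inter> ball (0::'d mvec) r)"
  have B: "open B" "B \<noteq> {}" "bounded B"
    using open_future_cone future_cone_meets_ball[OF r] by (auto simp: B_def bounded_Int)
  have Bm: "B \<in> lmeasurable" using B by (intro lmeasurable_open)
  have b: "measure lebesgue B > 0"
    using open_not_negligible[OF B(1,2)] negligible_iff_measure[of B] Bm
    by (simp add: zero_less_measure_iff)
  have pB: "(+) p ` B \<in> sets borel" "measure lborel ((+) p ` B) = measure lebesgue B"
    "emeasure lborel ((+) p ` B) < \<infinity>"
  proof -
    have o: "open ((+) p ` B)" "bounded ((+) p ` B)"
      using B by (auto intro: open_translation bounded_translation)
    show s: "(+) p ` B \<in> sets borel" using o(1) by (rule borel_open)
    show "emeasure lborel ((+) p ` B) < \<infinity>" using o(2) by (rule emeasure_bounded_finite)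
    have "measure lborel ((+) p ` B) = measure lebesgue ((+) p ` B)"
      using s by (intro measure_completion[symmetric]) simp
    then show "measure lborel ((+) p ` B) = measure lebesgue B"
      using measure_translation[of p B] by (rule trans)
  qed
  define c where "c = h \<eta> - e - r * norm \<eta>"
  have "exp (N * c) * measure lebesgue B = (\<integral>q. exp (N * c) * indicator ((+) p ` B) q \<partial>lborel)"
    unfolding pB(2)[symmetric] by (simp only: integral_mult_right_zero Bochner_Integration.integral_indicator space_lborel space_borel Int_UNIV_right)
  also have "\<dots> \<le> mass K (flip (N *\<^sub>R \<eta>))"
    unfolding mass_integral(2)[OF cone]
  proof (rule integral_mono)
    show "integrable lborel (\<lambda>q. exp (N * c) * indicator ((+) p ` B) q :: real)"
      by (intro integrable_mult_right integrable_real_indicator pB(3)) (simp only: sets_lborel pB(1))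
    fix q
    show "exp (N * c) * indicator ((+) p ` B) q \<le> indicator K q * exp (mink q (N *\<^sub>R \<eta>))"
    proof (cases "q \<in> (+) p ` B")
      case True
      then obtain y where y: "q = p + y" "y \<in> future_cone" "norm y < r"
        by (auto simp: B_def)
      have "\<bar>mink y \<eta>\<bar> \<le> r * norm \<eta>"
        by (rule order_trans[OF mink_le_norm]) (use y(3) in \<open>simp add: mult_right_mono\<close>)
      then have "c \<le> mink q \<eta>"
        using p(2) by (simp add: y(1) c_def mink_simps)
      moreover have "q \<in> K" using K_future[OF p(1) y(2)] y(1) by simp
      ultimately show ?thesis using True N by (simp add: mink_simps)
    qed simp
  qed (rule mass_integral(1)[OF cone])
  finally have "ln (exp (N * c) * measure lebesgue B) \<le> ln (mass K (flip (N *\<^sub>R \<eta>)))"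
    using b mass_pos[OF flip_future_cone_decay[OF cone]] by (subst ln_le_cancel_iff) auto
  then have "N * c + ln (measure lebesgue B) \<le> log_laplace K (N *\<^sub>R flip \<eta>)"
    using b by (simp add: log_laplace_def ln_mult linear_scale[OF linear_flip])
  then have "(N * c + ln (measure lebesgue B)) / N \<le> log_laplace K (N *\<^sub>R flip \<eta>) / N"
    using N by (intro divide_right_mono) auto
  then have "c + ln (measure lebesgue B) / N \<le> soft_support N \<eta>"
    using N by (simp add: soft_support_def add_divide_distrib)
  then show "h \<eta> - r * norm \<eta> + ln (measure lebesgue (future_cone \<inter> ball (0::'d mvec) r)) / N
      \<le> soft_support N \<eta> + e"
    by (simp add: c_def B_def)
qed

text \<open>
  The two bounds are uniform on the compact part of the hyperboloid that meets every orbit, and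
  \<open>F\<^sub>N - h\<close> is constant on orbits.
\<close>

lemma soft_support_uniform:
  assumes e: "e > 0"
  obtains N0 where "N0 > 0" "\<And>N \<eta>. N \<ge> N0 \<Longrightarrow> \<eta> \<in> hyp \<Longrightarrow> \<bar>soft_support N \<eta> - h \<eta>\<bar> \<le> e"
proof -
  obtain R where R: "\<And>\<eta>. \<eta> \<in> hyp \<Longrightarrow> \<exists>\<gamma>\<in>\<Gamma>. norm (\<gamma> *v \<eta>) < R"
    using uniform_lattice_bounded_representatives[OF lattice] by blast
  define C where "C = (hyp \<inter> cball 0 R :: 'd mvec set)"
  have "compact C"
    unfolding C_def by (intro closed_Int_compact closed_hyp compact_cball)
  moreover have "continuous_on C (\<lambda>\<eta>. log_laplace K (flip \<eta>))"
  proof -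
    have "continuous_on C (soft_support 1)"
      by (intro continuous_at_imp_continuous_on ballI
          has_derivative_continuous[OF soft_support_has_derivative]) (auto simp: C_def)
    then show ?thesis by (simp add: soft_support_def[abs_def])
  qed
  ultimately have "bounded ((\<lambda>\<eta>. log_laplace K (flip \<eta>)) ` C)"
    by (intro compact_imp_bounded compact_continuous_image)
  then obtain M where M: "\<And>\<eta>. \<eta> \<in> C \<Longrightarrow> \<bar>log_laplace K (flip \<eta>)\<bar> \<le> M"
    by (auto simp: bounded_iff)
  obtain p where p: "p \<in> K" using K_nonempty by blast
  define M' where "M' = M + norm p * R"
  have upper: "log_laplace K (flip \<eta>) - h \<eta> \<le> M'" if "\<eta> \<in> C" for \<eta>
  proof -
    have "norm p * norm \<eta> \<le> norm p * R"
      using that by (intro mult_left_mono) (auto simp: C_def)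
    then show ?thesis
      using M[OF that] mink_le_norm[of p \<eta>] support_ge[OF p, of \<eta>] that
      unfolding M'_def C_def by (auto simp: abs_le_iff)
  qed
  define r where "r = e / (2 * (\<bar>R\<bar> + 1))"
  have r: "r > 0" "r * \<bar>R\<bar> \<le> e / 2"
    using e by (auto simp: r_def field_simps)
  define L where "L = ln (measure lebesgue (future_cone \<inter> ball (0::'d mvec) r))"
  define N0 where "N0 = 1 + \<bar>M'\<bar> / e + 2 * \<bar>L\<bar> / e"
  have N0: "N0 \<ge> 1" using e by (simp add: N0_def)
  have on_C: "\<bar>soft_support N \<eta> - h \<eta>\<bar> \<le> e" if N: "N \<ge> N0" and \<eta>: "\<eta> \<in> C" for N \<eta>
  proof -
    have N1: "N \<ge> 1" using N N0 by simp
    have "\<bar>M'\<bar> / e \<le> N" "2 * \<bar>L\<bar> / e \<le> N"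
      using N e divide_nonneg_pos[of "\<bar>M'\<bar>" e] divide_nonneg_pos[of "2 * \<bar>L\<bar>" e]
      unfolding N0_def by linarith+
    then have "\<bar>M'\<bar> / N \<le> e" "\<bar>L\<bar> / N \<le> e / 2"
      using e N1 by (simp_all add: field_simps)
    then have M'N: "M' / N \<le> e" and LN: "- e / 2 \<le> L / N"
      using N1 by (auto simp: abs_if field_simps split: if_splits)
    have "soft_support N \<eta> \<le> h \<eta> + (log_laplace K (flip \<eta>) - h \<eta>) / N"
      using \<eta> N1 by (intro soft_support_le) (auto simp: C_def)
    also have "\<dots> \<le> h \<eta> + M' / N"
      using upper[OF \<eta>] N1 by (intro add_left_mono divide_right_mono) auto
    finally have "soft_support N \<eta> \<le> h \<eta> + e" using M'N by simp
    moreover have "h \<eta> - r * norm \<eta> + L / N \<le> soft_support N \<eta>"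
      unfolding L_def using \<eta> N1 r by (intro soft_support_ge) (auto simp: C_def)
    moreover have "r * norm \<eta> \<le> e / 2"
    proof -
      have "r * norm \<eta> \<le> r * \<bar>R\<bar>"
        using \<eta> r(1) by (intro mult_left_mono) (auto simp: C_def)
      then show ?thesis using r(2) by simp
    qed
    ultimately show ?thesis using LN by (simp add: abs_le_iff)
  qed
  have "\<bar>soft_support N \<eta> - h \<eta>\<bar> \<le> e" if N: "N \<ge> N0" and \<eta>: "\<eta> \<in> hyp" for N \<eta>
  proof -
    obtain \<gamma> where \<gamma>: "\<gamma> \<in> \<Gamma>" "norm (\<gamma> *v \<eta>) < R" using R[OF \<eta>] by blast
    then have "\<gamma> *v \<eta> \<in> C"
      using SO_plus_hyp[OF SO_plus \<eta>] by (simp add: C_def)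
    from on_C[OF N this] show ?thesis
      using soft_support_equivariant[OF \<gamma>(1) \<eta>, of N] support_equivariant[OF \<gamma>(1) \<eta>] N N0
      by simp
  qed
  then show ?thesis using that[of N0] N0 by auto
qed


definition body_below :: "('d mvec \<Rightarrow> real) \<Rightarrow> 'd mvec set" where
  "body_below g = {p. \<forall>\<eta>\<in>hyp. mink p \<eta> \<le> g \<eta>}"

lemma tau_convex_body_below:
  assumes ne: "body_below g \<noteq> {}"
    and equi: "\<And>\<gamma> \<eta>. \<gamma> \<in> \<Gamma> \<Longrightarrow> \<eta> \<in> hyp \<Longrightarrow> g (\<gamma> *v \<eta>) = g \<eta> + mink (\<tau> \<gamma>) (\<gamma> *v \<eta>)"
  shows "tau_convex \<Gamma> \<tau> (body_below g)"
  unfolding tau_convex_def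
proof (intro conjI ballI)
  have eq: "body_below g = (\<Inter>\<eta>\<in>hyp. {p. flip \<eta> \<bullet> p \<le> g \<eta>})"
    by (auto simp: body_below_def mink_flip inner_commute)
  show "closed (body_below g)"
    unfolding eq by (intro closed_INT ballI closed_halfspace_le)
  show "convex (body_below g)"
    unfolding eq by (intro convex_INT convex_halfspace_le)
  show "body_below g \<noteq> UNIV"
  proof
    define \<eta> :: "'d mvec" where "\<eta> = axis None 1"
    have \<eta>: "\<eta> \<in> hyp" "mink \<eta> \<eta> = -1"
      using hyp_nonempty by (auto simp: \<eta>_def hyp_def)
    assume "body_below g = UNIV"
    then have "mink (- (g \<eta> + 1) *\<^sub>R \<eta>) \<eta> \<le> g \<eta>"
      using \<eta>(1) unfolding body_below_def by blast
    then show False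
      by (simp only: mink_simps \<eta>(2)) simp
  qed
  show "X + Y \<in> body_below g" if "X \<in> body_below g" "Y \<in> future_cone" for X Y
    using that mink_future_cone_neg[OF that(2)] by (fastforce simp: body_below_def mink_simps)
  fix f assume "f \<in> affine_maps \<Gamma> \<tau>"
  then obtain \<gamma> where \<gamma>: "\<gamma> \<in> \<Gamma>" and f: "f = (\<lambda>X. \<gamma> *v X + \<tau> \<gamma>)"
    by (auto simp: affine_maps_def)
  note A = SO_plus[OF \<gamma>]
  have mem: "f p \<in> body_below g \<longleftrightarrow> p \<in> body_below g" for p
  proof -
    have onto: "(*v) \<gamma> ` hyp = hyp"
      by (rule SO_plus_image_hyp[OF A])
    have "f p \<in> body_below g \<longleftrightarrow> (\<forall>\<eta>\<in>hyp. mink (f p) (\<gamma> *v \<eta>) \<le> g (\<gamma> *v \<eta>))"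
      unfolding body_below_def by (subst onto[symmetric]) auto
    also have "\<dots> \<longleftrightarrow> p \<in> body_below g"
      unfolding body_below_def using equi[OF \<gamma>] by (auto simp: f mink_simps SO_plusD(1)[OF A])
    finally show ?thesis .
  qed
  have "surj f"
  proof -
    have "surj ((*v) \<gamma>)"
      using SO_plus_inj[OF A] linear_injective_imp_surjective matrix_vector_mul_linear by blast
    then have "\<exists>X. Z - \<tau> \<gamma> = \<gamma> *v X" for Z by (rule surjD)
    then have "\<exists>X. Z = f X" for Z
      by (metis f diff_add_cancel)
    then show ?thesis by (auto simp: surj_def)
  qed
  then show "f ` body_below g = body_below g"
    using mem by (auto simp: image_iff) (metis surjD)
qed (rule ne)

text \<open>
  The hypothesis makes the multiple of \<open>\<eta>\<close> in the touching point nonnegative; by the reversed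
  Cauchy-Schwarz inequality adding it lowers the linear functional at every other \<open>\<zeta>\<close> at least as much
  as at \<open>\<eta>\<close>, so the tangent inequality survives.
\<close>

lemma soft_support_tau_support_function:
  assumes N: "N > 0" and e: "\<And>\<eta>. \<eta> \<in> hyp \<Longrightarrow> soft_support N \<eta> - e \<le> mink (soft_point N \<eta>) \<eta>"
  shows "tau_support_function \<Gamma> \<tau> (\<lambda>\<eta>. soft_support N \<eta> - e)"
proof -
  let ?g = "\<lambda>\<eta>. soft_support N \<eta> - e"
  have touch: "\<exists>p\<in>body_below ?g. mink p \<eta> = ?g \<eta>" if \<eta>: "\<eta> \<in> hyp" for \<eta>
  proof -
    define c where "c = mink (soft_point N \<eta>) \<eta> - ?g \<eta>"
    define p where "p = soft_point N \<eta> + c *\<^sub>R \<eta>"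
    have c: "c \<ge> 0" using e[OF \<eta>] by (simp add: c_def)
    have "mink p \<zeta> \<le> ?g \<zeta>" if \<zeta>: "\<zeta> \<in> hyp" for \<zeta>
    proof -
      have "mink p \<zeta> = mink (soft_point N \<eta>) \<zeta> + c * mink \<eta> \<zeta>"
        by (simp add: p_def mink_simps)
      also have "\<dots> \<le> mink (soft_point N \<eta>) \<zeta> - c"
        using mult_left_mono[OF mink_hyp_le[OF \<eta> \<zeta>] c] by simp
      also have "\<dots> = soft_support N \<eta> + mink (soft_point N \<eta>) (\<zeta> - \<eta>) - e"
        by (simp add: c_def mink_simps)
      also have "\<dots> \<le> ?g \<zeta>"
        using soft_support_tangent[OF hyp_in_future_cone[OF \<eta>] hyp_in_future_cone[OF \<zeta>] N] by simp
      finally show ?thesis .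
    qed
    moreover have "mink p \<eta> = ?g \<eta>"
      using \<eta> by (simp add: p_def mink_simps c_def hyp_def)
    ultimately show ?thesis
      by (auto simp: body_below_def)
  qed
  have "hyp_support_function (body_below ?g) ?g"
    unfolding hyp_support_function_def
  proof
    fix \<eta> :: "'d mvec" assume \<eta>: "\<eta> \<in> hyp"
    obtain p where p: "p \<in> body_below ?g" "mink p \<eta> = ?g \<eta>"
      using touch[OF \<eta>] by blast
    show "ereal (?g \<eta>) = (SUP p\<in>body_below ?g. ereal (mink p \<eta>))"
    proof (rule antisym)
      show "ereal (?g \<eta>) \<le> (SUP p\<in>body_below ?g. ereal (mink p \<eta>))"
        using p by (intro SUP_upper2) auto
      show "(SUP p\<in>body_below ?g. ereal (mink p \<eta>)) \<le> ereal (?g \<eta>)"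
        using \<eta> by (intro SUP_least) (auto simp: body_below_def)
    qed
  qed
  moreover have "tau_convex \<Gamma> \<tau> (body_below ?g)"
  proof (rule tau_convex_body_below)
    show "body_below ?g \<noteq> {}"
      using touch[OF hyp_nonempty] by blast
  qed (simp add: soft_support_equivariant N)
  ultimately show ?thesis
    by (auto simp: tau_support_function_def)
qed

lemma soft_support_C2_plus:
  assumes N: "N > 0" and e: "\<And>\<eta>. \<eta> \<in> hyp \<Longrightarrow> soft_support N \<eta> - e < mink (soft_point N \<eta>) \<eta>"
  shows "C2_plus (\<lambda>\<eta>. soft_support N \<eta> - e)"
proof (rule C2_plusI)
  let ?D = "\<lambda>\<eta> v. tilted_cov K (N *\<^sub>R flip \<eta>) (N *\<^sub>R flip v)"
  note decay = scaled_decay[OF hyp_in_future_cone N]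
  fix \<eta> :: "'d mvec" assume \<eta>: "\<eta> \<in> hyp"
  show "((\<lambda>\<eta>. soft_support N \<eta> - e) has_derivative mink (soft_point N \<eta>)) (at \<eta>)"
    using has_derivative_diff[OF soft_support_has_derivative[OF \<eta> N] has_derivative_const[of e]]
    by simp
  show "(soft_point N has_derivative ?D \<eta>) (at \<eta>)"
    by (rule soft_point_has_derivative[OF \<eta> N])
  fix v assume v: "v \<in> hyp_tangent \<eta>" "v \<noteq> 0"
  have "0 \<le> N * mink (?D \<eta> v) v"
    using tilted_cov_nonneg[OF decay[OF \<eta>], of "N *\<^sub>R flip v"] by (simp add: mink_flip)
  then have "0 \<le> mink (?D \<eta> v) v"
    using N by (simp add: zero_le_mult_iff)
  moreover have "(mink (soft_point N \<eta>) \<eta> - (soft_support N \<eta> - e)) * mink v v > 0"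
    using e[OF \<eta>] mink_tangent_pos[OF \<eta> v] by simp
  ultimately show "mink (?D \<eta> v) v + (mink (soft_point N \<eta>) \<eta> - (soft_support N \<eta> - e)) * mink v v > 0"
    by linarith
next
  fix v
  show "continuous_on hyp (\<lambda>\<eta>. tilted_cov K (N *\<^sub>R flip \<eta>) (N *\<^sub>R flip v))"
    by (rule continuous_on_compose2[OF continuous_on_tilted_cov continuous_on_scaled_flip])
      (use scaled_decay[OF hyp_in_future_cone N] in auto)
qed

lemma C2_plus_approximation:
  assumes \<delta>: "\<delta> > 0"
  shows "\<exists>g. tau_support_function \<Gamma> \<tau> g \<and> C2_plus g \<and> (\<forall>\<eta>\<in>hyp. \<bar>h \<eta> - g \<eta>\<bar> \<le> \<delta>)"
proof -
  obtain N0 where N0: "N0 > 0"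
    and close: "\<And>N \<eta>. N \<ge> N0 \<Longrightarrow> \<eta> \<in> hyp \<Longrightarrow> \<bar>soft_support N \<eta> - h \<eta>\<bar> \<le> \<delta> / 8"
    using soft_support_uniform[of "\<delta> / 8"] \<delta> by auto
  define N where "N = 2 * N0"
  have N: "N > 0" "N \<ge> N0" "N / 2 \<ge> N0" using N0 by (auto simp: N_def)
  have gap: "soft_support N \<eta> - \<delta> / 2 < mink (soft_point N \<eta>) \<eta>" if "\<eta> \<in> hyp" for \<eta>
    using mink_soft_point_ge[OF that N(1)] close[OF N(2) that] close[OF N(3) that] \<delta>
    unfolding abs_le_iff by linarith
  have "\<bar>h \<eta> - (soft_support N \<eta> - \<delta> / 2)\<bar> \<le> \<delta>" if "\<eta> \<in> hyp" for \<eta>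
    using close[OF N(2) that] \<delta> unfolding abs_le_iff by linarith
  moreover have "tau_support_function \<Gamma> \<tau> (\<lambda>\<eta>. soft_support N \<eta> - \<delta> / 2)"
    using gap by (intro soft_support_tau_support_function N(1)) (simp add: less_imp_le)
  moreover have "C2_plus (\<lambda>\<eta>. soft_support N \<eta> - \<delta> / 2)"
    using gap by (intro soft_support_C2_plus N(1))
  ultimately show ?thesis by blast
qed

end

theorem theoremA1:
  fixes \<Gamma> :: "'d::finite mmat set"
    and \<tau> :: "'d mmat \<Rightarrow> 'd mvec"
    and h :: "'d mvec \<Rightarrow> real"
    and \<delta> :: real
  assumes "CARD('d) \<ge> 2"
    and "uniform_lattice \<Gamma>"
    and "torsion_free \<Gamma>"
    and "cocycle \<Gamma> \<tau>"
    and "tau_support_function \<Gamma> \<tau> h"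
    and "\<delta> > 0"
  shows "\<exists>h\<^sub>\<delta>. tau_support_function \<Gamma> \<tau> h\<^sub>\<delta> \<and> C2_plus h\<^sub>\<delta> \<and>
           (\<forall>\<eta>\<in>hyp. \<bar>h \<eta> - h\<^sub>\<delta> \<eta>\<bar> \<le> \<delta>)"
proof -
  obtain K where "tau_convex \<Gamma> \<tau> K" "hyp_support_function K h"
    using assms(5) by (auto simp: tau_support_function_def)
  then interpret tau_convex_body \<Gamma> \<tau> K h
    using assms(2) by unfold_locales
  show ?thesis
    using assms(6) by (rule C2_plus_approximation)
qed

end
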